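(* Let $m,n,r,s,\lambda$ be positive integers with $m>4$ and $n\ge 4m$. Any $r$-factorization of $\lambda K_m^4$ can be extended to a connected $s$-factorization of $\lambda K_n^4$ if and only if (i) $(m,r,\lambda)$ and $(n,s,\lambda)$ are $4$-admissible; (ii) $1<s/r\le\binom{n-1}{3}/\binom{m-1}{3}$.
   Context: $\lambda K_n^h$: $n$ vertices, every $h$-subset an edge of multiplicity $\lambda$; $\lambda K_m^h$ is its sub-hypergraph induced on a fixed set of $m$ vertices. An $r$-factor is a spanning sub-hypergraph in which every vertex has degree $r$; an $r$-factorization is a partition of the edges into $r$-factors. An $r$-factorization of $\lambda K_m^h$ extends to a connected $s$-factorization of $\lambda K_n^h$ if there is a partition of the edges of $\lambda K_n^h$ into connected $s$-factors such that each given $r$-factor is contained in one of them and distinct $r$-factors are contained in distinct $s$-factors. $(n,r,\lambda)$ is $h$-admissible if $h\mid rn$ and $r\mid\lambda\binom{n-1}{h-1}$. *)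

theory Defs
  imports Complex_Main "HOL-Library.Disjoint_Sets" "HOL-Library.Ramsey"
begin

(* Edge multiplicity is represented by labels: (e, i) is the i-th copy of the vertex set e.
   A sub-hypergraph on a vertex set V is then a plain set of labelled edges. *)
type_synonym 'a edge = "'a set \<times> nat"

definition complete_hypergraph :: "nat \<Rightarrow> nat \<Rightarrow> 'a set \<Rightarrow> 'a edge set" where
  "complete_hypergraph lam h V = nsets V h \<times> {..<lam}"

definition induced :: "'a edge set \<Rightarrow> 'a set \<Rightarrow> 'a edge set" where
  "induced E W = {x \<in> E. fst x \<subseteq> W}"

lemma induced_complete_hypergraph:
  "W \<subseteq> V \<Longrightarrow> induced (complete_hypergraph lam h V) W = complete_hypergraph lam h W"
  by (auto simp: induced_def complete_hypergraph_def nsets_def)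

definition degree :: "'a edge set \<Rightarrow> 'a \<Rightarrow> nat" where
  "degree F v = card {x \<in> F. v \<in> fst x}"

definition is_factor :: "nat \<Rightarrow> 'a set \<Rightarrow> 'a edge set \<Rightarrow> 'a edge set \<Rightarrow> bool" where
  "is_factor r V E F \<longleftrightarrow> F \<subseteq> E \<and> (\<forall>v\<in>V. degree F v = r)"

definition is_factorization :: "nat \<Rightarrow> 'a set \<Rightarrow> 'a edge set \<Rightarrow> 'a edge set set \<Rightarrow> bool" where
  "is_factorization r V E P \<longleftrightarrow> partition_on E P \<and> (\<forall>F\<in>P. is_factor r V E F)"

definition adjacency :: "'a edge set \<Rightarrow> ('a \<times> 'a) set" where
  "adjacency F = {(u, v). \<exists>x\<in>F. u \<in> fst x \<and> v \<in> fst x}"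

definition connected_hypergraph :: "'a set \<Rightarrow> 'a edge set \<Rightarrow> bool" where
  "connected_hypergraph V F \<longleftrightarrow> (\<forall>u\<in>V. \<forall>v\<in>V. (u, v) \<in> (adjacency F)\<^sup>*)"

definition extends_to_connected_factorization ::
    "'a edge set set \<Rightarrow> nat \<Rightarrow> 'a set \<Rightarrow> 'a edge set \<Rightarrow> bool" where
  "extends_to_connected_factorization P s V E \<longleftrightarrow>
     (\<exists>Q. is_factorization s V E Q \<and> (\<forall>G\<in>Q. connected_hypergraph V G) \<and>
          (\<exists>f. inj_on f P \<and> (\<forall>F\<in>P. f F \<in> Q \<and> F \<subseteq> f F)))"

definition admissible :: "nat \<Rightarrow> nat \<Rightarrow> nat \<Rightarrow> nat \<Rightarrow> bool" where
  "admissible h n r lam \<longleftrightarrow> h dvd r * n \<and> r dvd lam * ((n - 1) choose (h - 1))"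

end

(* Contract W to one vertex \<beta> and its complement to one vertex \<alpha>. New edges then only have a type
   \<beta>^a \<alpha>^(4-a) with a < 4, and since every given r-factor has the same degree at all vertices of W,
   only numbers x i a (edges of type a in colour i) with prescribed row and column sums are needed.
   Such numbers are found greedily for a = 3, 2 and are then forced for a = 1, 0; the hypothesis
   n >= 4m makes x i 0 nonnegative.
   Next \<beta> and then \<alpha> are split back into vertices, one vertex at a time, as in Baranyai's theorem:
   each split is an integral rounding of the fractional flow that gives the split-off vertex its
   share 1/p of everything. While \<alpha> is split, a finer rounding keeps every colour connected: the
   components of a colour at \<alpha> merge at such a rate that their number t satisfies t + p <= s p + 1
   throughout (the edge bound of a connected bipartite graph on t + p vertices). Initially every
   new edge may count as its own component. All new edges of a colour thus become connected
   through the vertices outside W, and every vertex lies on a new edge of each colour. *)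

theory Submission
  imports Defs
begin

section \<open>Rounding of flows\<close>

text \<open>Call each occurrence of the amalgamated vertex in an edge a hinge. Exact splitting rests
  on \<open>r * (p choose r) = p * ((p - 1) choose (r - 1))\<close>: among the edges of one label
  the number of hinges is divisible by \<open>p\<close>, so the split-off vertex can receive exactly
  its share of every label, and Pascal's rule then gives the right number of edges that it misses.
  The hinges of one colour are divisible by \<open>p\<close> as well. Edges nested in blocks nested
  in colours form one laminar family and the labels form another; two such families make a network,
  so all the shares can be rounded at once. The bound on the number of components is not sufficient
  by itself: a merged component that has spent its last hinge could not be joined to anything later.
  Hence each split must also leave a hinge on some component that it touches. Connectedness can be
  left to the second phase because every new edge has a vertex outside \<open>W\<close>. The
  hypothesis \<open>n >= 4 * m\<close> serves a second time, in the greedy choice: a colour may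
  waste up to two units of degree, and \<open>2 * \<kappa> \<le> B 1\<close> absorbs this.\<close>

lemma nontrivial_solution:
  fixes a :: "'q \<Rightarrow> 'u \<Rightarrow> real"
  assumes "finite Q" "finite U" "card Q < card U"
  shows "\<exists>z. (\<exists>u\<in>U. z u \<noteq> 0) \<and> (\<forall>q\<in>Q. (\<Sum>u\<in>U. a q u * z u) = 0)"
  using assms
proof (induction Q arbitrary: a U rule: finite_induct)
  case empty
  then have "U \<noteq> {}" by auto
  then show ?case by (intro exI[of _ "\<lambda>_. 1"]) auto
next
  case (insert q Q)
  show ?case
  proof (cases "\<exists>u\<in>U. a q u \<noteq> 0")
    case False
    have "card Q < card U" using insert by simp
    from insert.IH[OF insert.prems(1) this, of a] False show ?thesis by auto
  next
    case True
    then obtain u0 where u0: "u0 \<in> U" "a q u0 \<noteq> 0" by blast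
    define U' where "U' = U - {u0}"
    \<comment> \<open>Gaussian elimination: \<open>a'\<close> is the system left after equation
      \<open>q\<close> is solved for \<open>z u0\<close>, and \<open>w\<close> below substitutes
      back.\<close>
    define a' where "a' q' u = a q' u - a q' u0 * a q u / a q u0" for q' u
    have U: "U = insert u0 U'" "u0 \<notin> U'" "finite U'" using u0 insert.prems by (auto simp: U'_def)
    have "card Q < card U'" using insert.prems insert.hyps U by simp
    from insert.IH[OF U(3) this, of a'] obtain z where
      z: "\<exists>u\<in>U'. z u \<noteq> 0" "\<And>q. q \<in> Q \<Longrightarrow> (\<Sum>u\<in>U'. a' q u * z u) = 0" by blast
    define w where "w = z(u0 := - (\<Sum>u\<in>U'. a q u * z u) / a q u0)"
    have sum_w: "(\<Sum>u\<in>U. a q' u * w u) = a q' u0 * w u0 + (\<Sum>u\<in>U'. a q' u * z u)" for q'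
    proof -
      have "(\<Sum>u\<in>U'. a q' u * w u) = (\<Sum>u\<in>U'. a q' u * z u)"
        using U by (intro sum.cong) (auto simp: w_def)
      then show ?thesis using U by simp
    qed
    have "(\<Sum>u\<in>U. a q' u * w u) = 0" if "q' \<in> insert q Q" for q'
    proof (cases "q' = q")
      case True
      then show ?thesis using u0 sum_w by (simp add: w_def)
    next
      case False
      then have "0 = (\<Sum>u\<in>U'. a' q' u * z u)" using z that by auto
      also have "\<dots> = (\<Sum>u\<in>U'. a q' u * z u) - (\<Sum>u\<in>U'. a q' u0 / a q u0 * (a q u * z u))"
        by (simp add: a'_def sum_subtractf algebra_simps)
      also have "\<dots> = (\<Sum>u\<in>U'. a q' u * z u) - a q' u0 / a q u0 * (\<Sum>u\<in>U'. a q u * z u)"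
        by (simp add: sum_distrib_left)
      finally show ?thesis using u0 sum_w by (simp add: w_def)
    qed
    moreover have "\<exists>u\<in>U. w u \<noteq> 0" using z U by (auto simp: w_def)
    ultimately show ?thesis by blast
  qed
qed

text \<open>Signed incidence matrix of a directed multigraph: weighted by a flow, row
  \<open>v\<close> gives the net inflow at \<open>v\<close>. A loop would contribute 0, which is why
  loops are excluded below.\<close>

definition incidence :: "('e \<Rightarrow> 'v) \<Rightarrow> ('e \<Rightarrow> 'v) \<Rightarrow> 'v \<Rightarrow> 'e \<Rightarrow> real" where
  "incidence tail head v e = of_bool (head e = v) - of_bool (tail e = v)"

text \<open>A dimension count takes the place of a search for a cycle: with every degree at least 2
  there are at least as many arcs as vertices, while the conservation equations have rank less than
  the number of vertices.\<close>

lemma nonzero_circulation: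
  assumes "finite A" "A \<noteq> {}" and noloop: "\<And>e. e \<in> A \<Longrightarrow> tail e \<noteq> head e"
    and deg: "\<And>v e. e \<in> A \<Longrightarrow> v = head e \<or> v = tail e \<Longrightarrow>
      \<exists>e'\<in>A. e' \<noteq> e \<and> (v = head e' \<or> v = tail e')"
  shows "\<exists>z. (\<exists>e\<in>A. z e \<noteq> 0) \<and> (\<forall>v. (\<Sum>e\<in>A. incidence tail head v e * z e) = 0)"
proof -
  define N where "N = head ` A \<union> tail ` A"
  have "finite N" using assms by (simp add: N_def)
  have "2 * card N = (\<Sum>v\<in>N. 2)" by simp
  also have "\<dots> \<le> (\<Sum>v\<in>N. card {e\<in>A. v = head e \<or> v = tail e})"
  proof (rule sum_mono)
    fix v assume "v \<in> N"
    then obtain e where e: "e \<in> A" "v = head e \<or> v = tail e" by (auto simp: N_def)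
    with deg obtain e' where e': "e' \<in> A" "e' \<noteq> e" "v = head e' \<or> v = tail e'" by blast
    have "card {e, e'} \<le> card {e\<in>A. v = head e \<or> v = tail e}"
      using e e' \<open>finite A\<close> by (intro card_mono) auto
    then show "2 \<le> card {e\<in>A. v = head e \<or> v = tail e}" using e' by simp
  qed
  also have "\<dots> = (\<Sum>e\<in>A. card {v\<in>N. v = head e \<or> v = tail e})"
    using \<open>finite A\<close> \<open>finite N\<close> sum.swap_restrict[of N A "\<lambda>_ _. 1::nat" "\<lambda>v e. v = head e \<or> v = tail e"]
    by simp
  also have "\<dots> = (\<Sum>e\<in>A. 2)"
  proof (rule sum.cong)
    fix e assume e: "e \<in> A"
    then have "{v\<in>N. v = head e \<or> v = tail e} = {head e, tail e}" by (auto simp: N_def)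
    with noloop[OF e] show "card {v\<in>N. v = head e \<or> v = tail e} = 2" by simp
  qed simp
  finally have "card N \<le> card A" by simp
  \<comment> \<open>Each column has one entry 1 and one entry -1, so the equations add up to 0 and
    the one at \<open>v0\<close> follows from the others. Omitting it leaves fewer equations than
    arcs.\<close>
  obtain v0 where v0: "v0 \<in> N" using \<open>A \<noteq> {}\<close> by (auto simp: N_def)
  have "card (N - {v0}) < card A"
    using \<open>card N \<le> card A\<close> v0 \<open>finite N\<close> card_Diff1_less[OF \<open>finite N\<close> v0] by linarith
  from nontrivial_solution[OF _ \<open>finite A\<close> this] obtain z where
    z: "\<exists>e\<in>A. z e \<noteq> 0" "\<And>v. v \<in> N - {v0} \<Longrightarrow> (\<Sum>e\<in>A. incidence tail head v e * z e) = 0"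
    using \<open>finite N\<close> by blast
  have "(\<Sum>e\<in>A. incidence tail head v e * z e) = 0" for v
  proof (cases "v \<in> N")
    case False
    then show ?thesis by (intro sum.neutral) (auto simp: N_def incidence_def)
  next
    case True
    have col: "(\<Sum>v\<in>N. incidence tail head v e) = 0" if "e \<in> A" for e
      using that \<open>finite N\<close> by (auto simp: incidence_def sum_subtractf of_bool_def N_def sum.delta)
    have "(\<Sum>v\<in>N. \<Sum>e\<in>A. incidence tail head v e * z e) = (\<Sum>e\<in>A. (\<Sum>v\<in>N. incidence tail head v e) * z e)"
      by (subst sum.swap) (simp add: sum_distrib_right)
    also have "\<dots> = 0" using col by simp
    finally have "(\<Sum>e\<in>A. incidence tail head v0 e * z e) = 0"
      using sum.remove[OF \<open>finite N\<close> v0, of "\<lambda>v. \<Sum>e\<in>A. incidence tail head v e * z e"] z(2) by simp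
    then show ?thesis using z(2) True by (cases "v = v0") auto
  qed
  with z(1) show ?thesis by blast
qed

text \<open>Pushing along a circulation supported on the fractional arcs changes no net inflow. The
  push stops as soon as one of these arcs becomes integral, so the number of fractional arcs drops,
  and no arc leaves the interval between its floor and its ceiling.\<close>

lemma flow_rounding:
  fixes x :: "'e \<Rightarrow> real"
  assumes "finite A" and noloop: "\<And>e. e \<in> A \<Longrightarrow> tail e \<noteq> head e"
    and "\<And>v. (\<Sum>e\<in>A. incidence tail head v e * x e) \<in> \<int>"
  shows "\<exists>y::'e \<Rightarrow> int. (\<forall>e\<in>A. \<lfloor>x e\<rfloor> \<le> y e \<and> y e \<le> \<lceil>x e\<rceil>) \<and>
    (\<forall>v. (\<Sum>e\<in>A. incidence tail head v e * y e) = (\<Sum>e\<in>A. incidence tail head v e * x e))"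
  using assms(3)
proof (induction "card {e\<in>A. x e \<notin> \<int>}" arbitrary: x rule: less_induct)
  case less
  define A' where "A' = {e\<in>A. x e \<notin> \<int>}"
  have A': "finite A'" "A' \<subseteq> A" using \<open>finite A\<close> by (auto simp: A'_def)
  show ?case
  proof (cases "A' = {}")
    case True
    then have x: "x e = of_int \<lfloor>x e\<rfloor>" if "e \<in> A" for e using that by (auto simp: A'_def elim: Ints_cases)
    then have "(\<Sum>e\<in>A. incidence tail head v e * of_int \<lfloor>x e\<rfloor>) = (\<Sum>e\<in>A. incidence tail head v e * x e)" for v
      by (intro sum.cong) auto
    moreover have "\<lfloor>x e\<rfloor> \<le> \<lceil>x e\<rceil>" for e by linarith
    ultimately show ?thesis by (intro exI[of _ "\<lambda>e. \<lfloor>x e\<rfloor>"]) auto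
  next
    case False
    \<comment> \<open>A vertex incident with exactly one fractional arc would have a fractional net
      inflow.\<close>
    have "\<exists>e'\<in>A'. e' \<noteq> e \<and> (v = head e' \<or> v = tail e')"
      if e: "e \<in> A'" "v = head e \<or> v = tail e" for v e
    proof (rule ccontr)
      assume no: "\<not> ?thesis"
      have eA: "e \<in> A" using e A' by auto
      have "(\<Sum>e\<in>A - {e}. incidence tail head v e * x e) \<in> \<int>"
      proof (rule Ints_sum)
        fix e' assume "e' \<in> A - {e}"
        then show "incidence tail head v e' * x e' \<in> \<int>"
          using no by (cases "e' \<in> A'") (auto simp: incidence_def A'_def)
      qed
      with less.prems[of v] have "incidence tail head v e * x e \<in> \<int>"
        using sum.remove[OF \<open>finite A\<close> eA, of "\<lambda>e. incidence tail head v e * x e"]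
        by (metis Ints_diff add_diff_cancel_right')
      moreover have "incidence tail head v e = 1 \<or> incidence tail head v e = -1"
        using e noloop[OF eA] by (auto simp: incidence_def)
      ultimately have "x e \<in> \<int>" by auto
      with e show False by (simp add: A'_def)
    qed
    then have "\<exists>z. (\<exists>e\<in>A'. z e \<noteq> 0) \<and> (\<forall>v. (\<Sum>e\<in>A'. incidence tail head v e * z e) = 0)"
      using A' False noloop by (intro nonzero_circulation) auto
    then obtain z where
      z: "\<exists>e\<in>A'. z e \<noteq> 0" "\<And>v. (\<Sum>e\<in>A'. incidence tail head v e * z e) = 0"
      by blast
    \<comment> \<open>The step length at which arc \<open>e\<close> reaches the integer it is moving
      towards; the least of these is the admissible push \<open>\<epsilon>\<close>.\<close>
    define t where "t e = (if z e > 0 then (\<lceil>x e\<rceil> - x e) / z e else (\<lfloor>x e\<rfloor> - x e) / z e)" for e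
    define Z where "Z = {e\<in>A'. z e \<noteq> 0}"
    have "finite Z" "Z \<noteq> {}" using z A' by (auto simp: Z_def)
    define \<epsilon> where "\<epsilon> = Min (t ` Z)"
    have "\<epsilon> \<in> t ` Z" unfolding \<epsilon>_def using \<open>finite Z\<close> \<open>Z \<noteq> {}\<close> by (intro Min_in) auto
    then obtain e0 where e0: "e0 \<in> Z" "\<epsilon> = t e0" by blast
    have eps_le: "\<epsilon> \<le> t e" if "e \<in> Z" for e using that \<open>finite Z\<close> by (simp add: \<epsilon>_def)
    have frac: "\<lfloor>x e\<rfloor> < x e \<and> x e < \<lceil>x e\<rceil>" if "e \<in> A'" for e
    proof -
      have "x e \<notin> \<int>" using that by (simp add: A'_def)
      then have "of_int \<lfloor>x e\<rfloor> \<noteq> x e" "of_int \<lceil>x e\<rceil> \<noteq> x e" by (metis Ints_of_int)+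
      then show ?thesis by linarith
    qed
    have t_pos: "t e > 0" if "e \<in> Z" for e
      using frac[of e] that by (auto simp: t_def Z_def divide_neg_neg)
    have "\<epsilon> > 0" using t_pos e0 by simp
    define x' where "x' e = x e + (if e \<in> A' then \<epsilon> * z e else 0)" for e
    have between: "\<lfloor>x e\<rfloor> \<le> x' e \<and> x' e \<le> \<lceil>x e\<rceil>" for e
    proof (cases "e \<in> Z")
      case True
      then have "z e \<noteq> 0" "e \<in> A'" by (auto simp: Z_def)
      consider "z e > 0" | "z e < 0" using \<open>z e \<noteq> 0\<close> by linarith
      then show ?thesis
      proof cases
        case 1
        have "\<epsilon> \<le> (\<lceil>x e\<rceil> - x e) / z e" using eps_le[OF True] 1 by (simp add: t_def)
        then have "\<epsilon> * z e \<le> \<lceil>x e\<rceil> - x e" using 1 by (simp add: pos_le_divide_eq)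
        moreover have "\<epsilon> * z e > 0" using \<open>\<epsilon> > 0\<close> 1 by simp
        ultimately show ?thesis using \<open>e \<in> A'\<close> frac[of e] by (simp add: x'_def)
      next
        case 2
        have "\<epsilon> \<le> (\<lfloor>x e\<rfloor> - x e) / z e" using eps_le[OF True] 2 by (simp add: t_def)
        then have "\<epsilon> * z e \<ge> \<lfloor>x e\<rfloor> - x e" using 2 by (simp add: neg_le_divide_eq)
        moreover have "\<epsilon> * z e < 0" using \<open>\<epsilon> > 0\<close> 2 by (simp add: mult_pos_neg)
        ultimately show ?thesis using \<open>e \<in> A'\<close> frac[of e] by (simp add: x'_def)
      qed
    next
      case False
      then have "x' e = x e" by (auto simp: x'_def Z_def)
      then show ?thesis by auto
    qed
    have net: "(\<Sum>e\<in>A. incidence tail head v e * x' e) = (\<Sum>e\<in>A. incidence tail head v e * x e)" for v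
    proof -
      have "(\<Sum>e\<in>A. incidence tail head v e * x' e) = (\<Sum>e\<in>A. incidence tail head v e * x e)
          + (\<Sum>e\<in>A. if e \<in> A' then \<epsilon> * (incidence tail head v e * z e) else 0)"
        unfolding sum.distrib[symmetric] by (intro sum.cong) (auto simp: x'_def algebra_simps)
      also have "(\<Sum>e\<in>A. if e \<in> A' then \<epsilon> * (incidence tail head v e * z e) else 0)
          = (\<Sum>e\<in>A'. \<epsilon> * (incidence tail head v e * z e))"
        using A' \<open>finite A\<close> by (simp add: sum.If_cases Int_absorb1)
      also have "\<dots> = 0" using z(2)[of v] by (simp flip: sum_distrib_left)
      finally show ?thesis by simp
    qed
    have "x' e0 \<in> \<int>"
    proof -
      have "z e0 \<noteq> 0" "e0 \<in> A'" using e0 by (auto simp: Z_def)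
      then have "x' e0 = of_int \<lceil>x e0\<rceil> \<or> x' e0 = of_int \<lfloor>x e0\<rfloor>"
        using e0 by (auto simp: x'_def t_def)
      then show ?thesis by auto
    qed
    have "x' e \<in> \<int>" if "e \<in> A" "e \<notin> A'" for e using that by (simp add: x'_def A'_def)
    then have "{e\<in>A. x' e \<notin> \<int>} \<subseteq> A' - {e0}" using \<open>x' e0 \<in> \<int>\<close> by auto
    then have "card {e\<in>A. x' e \<notin> \<int>} \<le> card (A' - {e0})" using A' by (intro card_mono) auto
    also have "\<dots> < card A'" using e0 A' by (intro card_Diff1_less) (auto simp: Z_def)
    finally have "card {e\<in>A. x' e \<notin> \<int>} < card {e\<in>A. x e \<notin> \<int>}" by (simp add: A'_def)
    from less.hyps[OF this] net less.prems obtain y :: "'e \<Rightarrow> int" where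
      y: "\<And>e. e \<in> A \<Longrightarrow> \<lfloor>x' e\<rfloor> \<le> y e \<and> y e \<le> \<lceil>x' e\<rceil>"
        "\<And>v. (\<Sum>e\<in>A. incidence tail head v e * y e) = (\<Sum>e\<in>A. incidence tail head v e * x e)"
      by auto
    have "\<lfloor>x e\<rfloor> \<le> y e \<and> y e \<le> \<lceil>x e\<rceil>" if "e \<in> A" for e
    proof -
      have "\<lfloor>x e\<rfloor> \<le> \<lfloor>x' e\<rfloor>" "\<lceil>x' e\<rceil> \<le> \<lceil>x e\<rceil>"
        using between[of e] by (auto simp: le_floor_iff ceiling_le_iff)
      then show ?thesis using y(1)[OF that] by linarith
    qed
    with y(2) show ?thesis by blast
  qed
qed

text \<open>Selects the hinges of one split-off vertex. The fractional solution takes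
  \<open>d e / p\<close> of every edge; its colour and label totals are integers and are therefore
  kept exactly, while a block total is rounded and so stays below its share plus 1.\<close>

lemma fair_selection:
  fixes d :: "'e \<Rightarrow> nat" and c :: "'e \<Rightarrow> 'c" and b :: "'e \<Rightarrow> 'b" and l :: "'e \<Rightarrow> 'l"
  assumes "finite E" "p > 0" and d_le: "\<And>e. e \<in> E \<Longrightarrow> d e \<le> p"
    and color: "\<And>i. i \<in> c ` E \<Longrightarrow> (\<Sum>e | e \<in> E \<and> c e = i. d e) = D i * p"
    and label: "\<And>j. p dvd (\<Sum>e | e \<in> E \<and> l e = j. d e)"
  shows "\<exists>I\<subseteq>E. (\<forall>e\<in>I. d e > 0) \<and> (\<forall>i\<in>c ` E. card {e\<in>I. c e = i} = D i) \<and>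
    (\<forall>j. p * card {e\<in>I. l e = j} = (\<Sum>e | e \<in> E \<and> l e = j. d e)) \<and>
    (\<forall>i \<beta>. p * card {e\<in>I. c e = i \<and> b e = \<beta>} < (\<Sum>e | e \<in> E \<and> c e = i \<and> b e = \<beta>. d e) + p)"
proof -
  \<comment> \<open>The network: colour to block, block to label (one arc per element of E).\<close>
  define blk where "blk e = (c e, b e)" for e
  define A :: "('e + ('c \<times> 'b)) set" where "A = Inl ` E \<union> Inr ` blk ` E"
  define x :: "'e + ('c \<times> 'b) \<Rightarrow> real" where
    "x = case_sum (\<lambda>e. d e / p) (\<lambda>\<beta>. (\<Sum>e | e \<in> E \<and> blk e = \<beta>. d e) / p)"
  define tail :: "'e + ('c \<times> 'b) \<Rightarrow> 'c + ('c \<times> 'b) + 'l" where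
    "tail = case_sum (\<lambda>e. Inr (Inl (blk e))) (\<lambda>\<beta>. Inl (fst \<beta>))"
  define head :: "'e + ('c \<times> 'b) \<Rightarrow> 'c + ('c \<times> 'b) + 'l" where
    "head = case_sum (\<lambda>e. Inr (Inr (l e))) (\<lambda>\<beta>. Inr (Inl \<beta>))"
  define net where "net w v = (\<Sum>a\<in>A. incidence tail head v a * w a)" for w v
  have split: "net w v = (\<Sum>e\<in>E. incidence tail head v (Inl e) * w (Inl e))
      + (\<Sum>\<beta>\<in>blk ` E. incidence tail head v (Inr \<beta>) * w (Inr \<beta>))" for v w
    unfolding net_def A_def using \<open>finite E\<close>
    by (subst sum.union_disjoint) (auto simp: sum.reindex simp del: image_image)
  have net_color: "net w (Inl i) = - (\<Sum>\<beta> | \<beta> \<in> blk ` E \<and> fst \<beta> = i. w (Inr \<beta>))" for w i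
    using \<open>finite E\<close>
    by (auto simp: split incidence_def tail_def head_def of_bool_def if_distrib sum.inter_filter
        simp flip: sum_negf intro!: sum.cong)
  have net_block: "net w (Inr (Inl \<beta>)) = w (Inr \<beta>) - (\<Sum>e | e \<in> E \<and> blk e = \<beta>. w (Inl e))"
    if "\<beta> \<in> blk ` E" for w \<beta>
  proof -
    have "(\<Sum>e\<in>E. incidence tail head (Inr (Inl \<beta>)) (Inl e) * w (Inl e))
        = - (\<Sum>e | e \<in> E \<and> blk e = \<beta>. w (Inl e))"
      using \<open>finite E\<close> 
      by (auto simp: incidence_def tail_def head_def sum.inter_filter simp flip: sum_negf intro!: sum.cong)
    moreover have "(\<Sum>\<beta>'\<in>blk ` E. incidence tail head (Inr (Inl \<beta>)) (Inr \<beta>') * w (Inr \<beta>'))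
        = (\<Sum>\<beta>'\<in>blk ` E. if \<beta>' = \<beta> then w (Inr \<beta>') else 0)"
      by (intro sum.cong) (auto simp: incidence_def tail_def head_def)
    ultimately show ?thesis using that \<open>finite E\<close> by (simp add: split)
  qed
  have net_block0: "net w (Inr (Inl \<beta>)) = 0" if "\<beta> \<notin> blk ` E" for w \<beta>
  proof -
    have "(\<Sum>e\<in>E. incidence tail head (Inr (Inl \<beta>)) (Inl e) * w (Inl e)) = 0"
      using that by (intro sum.neutral) (auto simp: incidence_def tail_def head_def)
    moreover have "(\<Sum>\<beta>'\<in>blk ` E. incidence tail head (Inr (Inl \<beta>)) (Inr \<beta>') * w (Inr \<beta>')) = 0"
      using that by (intro sum.neutral) (auto simp: incidence_def tail_def head_def)
    ultimately show ?thesis by (simp add: split)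
  qed
  have net_label: "net w (Inr (Inr j)) = (\<Sum>e | e \<in> E \<and> l e = j. w (Inl e))" for w j
  proof -
    have "(\<Sum>e\<in>E. incidence tail head (Inr (Inr j)) (Inl e) * w (Inl e))
        = (\<Sum>e\<in>E. if l e = j then w (Inl e) else 0)"
      by (intro sum.cong) (auto simp: incidence_def tail_def head_def)
    moreover have "(\<Sum>\<beta>\<in>blk ` E. incidence tail head (Inr (Inr j)) (Inr \<beta>) * w (Inr \<beta>)) = 0"
      by (intro sum.neutral) (auto simp: incidence_def tail_def head_def)
    ultimately show ?thesis using \<open>finite E\<close> by (simp add: split sum.inter_filter)
  qed
  have blocks: "(\<Sum>\<beta> | \<beta> \<in> blk ` E \<and> fst \<beta> = i. \<Sum>e | e \<in> E \<and> blk e = \<beta>. h e)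
      = (\<Sum>e | e \<in> E \<and> c e = i. h e)" for h :: "'e \<Rightarrow> real" and i
  proof -
    have "(\<Sum>\<beta> | \<beta> \<in> blk ` E \<and> fst \<beta> = i. \<Sum>e | e \<in> E \<and> blk e = \<beta>. h e)
       = (\<Sum>\<beta> | \<beta> \<in> blk ` E \<and> fst \<beta> = i. \<Sum>e | e \<in> {e\<in>E. c e = i} \<and> blk e = \<beta>. h e)"
      by (intro sum.cong) (auto simp: blk_def)
    also have "\<dots> = (\<Sum>e | e \<in> E \<and> c e = i. h e)"
      using \<open>finite E\<close> by (intro sum.group) (auto simp: blk_def)
    finally show ?thesis .
  qed
  have color_real: "(\<Sum>e | e \<in> E \<and> c e = i. real (d e)) = real (D i) * p" if "i \<in> c ` E" for i
    using arg_cong[OF color[OF that], of real] by simp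
  have x_color: "net x (Inl i) = - real (D i)" if "i \<in> c ` E" for i
    using blocks[of "\<lambda>e. d e / p" i] color_real[OF that] \<open>p > 0\<close>
    by (simp add: net_color x_def flip: sum_divide_distrib)
  have x_block: "net x (Inr (Inl \<beta>)) = 0" for \<beta>
    by (cases "\<beta> \<in> blk ` E") (simp_all add: net_block net_block0 x_def sum_divide_distrib)
  have x_label: "p * net x (Inr (Inr j)) = (\<Sum>e | e \<in> E \<and> l e = j. d e)" for j
    using \<open>p > 0\<close> by (simp add: net_label x_def flip: sum_divide_distrib)
  have "net x v \<in> \<int>" for v
  proof (cases v)
    case (Inl i)
    show ?thesis
    proof (cases "i \<in> c ` E")
      case False
      then have none: "{\<beta>. \<beta> \<in> blk ` E \<and> fst \<beta> = i} = {}" by (auto simp: blk_def)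
      show ?thesis by (simp only: Inl net_color none) simp
    qed (use Inl x_color in auto)
  next
    case (Inr v')
    show ?thesis
    proof (cases v')
      case (Inl \<beta>)
      then show ?thesis using Inr x_block by simp
    next
      case (Inr j)
      obtain r where "(\<Sum>e | e \<in> E \<and> l e = j. d e) = p * r" using label[of j] by blast
      then have "p * net x v = p * r" using x_label[of j] \<open>v = Inr v'\<close> Inr by simp
      then have "net x v = r" using \<open>p > 0\<close> by simp
      then show ?thesis by simp
    qed
  qed
  moreover have "finite A" using \<open>finite E\<close> by (simp add: A_def)
  moreover have "tail a \<noteq> head a" if "a \<in> A" for a using that by (auto simp: tail_def head_def A_def)
  ultimately obtain y where y: "\<And>a. a \<in> A \<Longrightarrow> \<lfloor>x a\<rfloor> \<le> y a \<and> y a \<le> \<lceil>x a\<rceil>"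
    "\<And>v. net (\<lambda>a. of_int (y a)) v = net x v"
    using flow_rounding[of A tail head x] unfolding net_def by blast
  \<comment> \<open>Since \<open>d e \<le> p\<close>, the share of an edge lies between 0 and 1, so
    the rounded flow is the indicator of a set, and an edge with no hinge left is not
    chosen.\<close>
  have y01: "0 \<le> y (Inl e) \<and> y (Inl e) \<le> 1 \<and> (d e = 0 \<longrightarrow> y (Inl e) = 0)" if "e \<in> E" for e
  proof -
    have "\<lfloor>x (Inl e)\<rfloor> \<le> y (Inl e)" "y (Inl e) \<le> \<lceil>x (Inl e)\<rceil>" using y(1)[of "Inl e"] that by (auto simp: A_def)
    moreover have "x (Inl e) \<le> 1" "0 \<le> x (Inl e)" using d_le[OF that] \<open>p > 0\<close> by (auto simp: x_def)
    moreover have "x (Inl e) = 0" if "d e = 0" using that by (simp add: x_def)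
    moreover have "\<lceil>x (Inl e)\<rceil> \<le> 1" "0 \<le> \<lfloor>x (Inl e)\<rfloor>"
      using \<open>x (Inl e) \<le> 1\<close> \<open>0 \<le> x (Inl e)\<close> by (simp_all add: ceiling_le_iff)
    ultimately show ?thesis by (intro conjI impI) (linarith, linarith, simp)
  qed
  define I where "I = {e\<in>E. y (Inl e) = 1}"
  have card_I: "real (card {e\<in>I. Q e}) = (\<Sum>e | e \<in> E \<and> Q e. y (Inl e))" for Q
  proof -
    have "(\<Sum>e | e \<in> E \<and> Q e. real_of_int (y (Inl e))) = (\<Sum>e | e \<in> E \<and> Q e. if e \<in> I then 1 else 0)"
    proof (rule sum.cong)
      fix e assume "e \<in> {e. e \<in> E \<and> Q e}"
      with y01[of e] have "y (Inl e) = 0 \<or> y (Inl e) = 1" "e \<in> E" by auto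
      then show "real_of_int (y (Inl e)) = (if e \<in> I then 1 else 0)" by (auto simp: I_def)
    qed simp
    also have "\<dots> = real (card ({e\<in>E. Q e} \<inter> I))" using \<open>finite E\<close> by (simp add: sum.If_cases)
    also have "{e\<in>E. Q e} \<inter> I = {e\<in>I. Q e}" by (auto simp: I_def)
    finally show ?thesis by simp
  qed
  have y_block: "y (Inr \<beta>) = real (card {e\<in>I. blk e = \<beta>})" if "\<beta> \<in> blk ` E" for \<beta>
    using y(2)[of "Inr (Inl \<beta>)"] x_block[of \<beta>] net_block[OF that, of "\<lambda>a. of_int (y a)"] card_I[of "\<lambda>e. blk e = \<beta>"]
    by simp
  have "card {e\<in>I. c e = i} = D i" if "i \<in> c ` E" for i
  proof -
    have "real (card {e\<in>I. c e = i}) = (\<Sum>e | e \<in> E \<and> c e = i. y (Inl e))" by (rule card_I)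
    also have "\<dots> = (\<Sum>\<beta> | \<beta> \<in> blk ` E \<and> fst \<beta> = i. \<Sum>e | e \<in> E \<and> blk e = \<beta>. y (Inl e))"
      using blocks[of "\<lambda>e. y (Inl e)" i] by simp
    also have "\<dots> = (\<Sum>\<beta> | \<beta> \<in> blk ` E \<and> fst \<beta> = i. y (Inr \<beta>))"
      using y_block card_I by (auto intro!: sum.cong)
    also have "\<dots> = D i"
      using net_color[of "\<lambda>a. of_int (y a)" i] y(2)[of "Inl i"] x_color[OF that] by simp
    finally show ?thesis by simp
  qed
  moreover have "p * card {e\<in>I. l e = j} = (\<Sum>e | e \<in> E \<and> l e = j. d e)" for j
  proof -
    have "real (card {e\<in>I. l e = j}) = net x (Inr (Inr j))"
      using y(2)[of "Inr (Inr j)"] card_I[of "\<lambda>e. l e = j"] by (simp add: net_label)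
    then have "real (p * card {e\<in>I. l e = j}) = real (\<Sum>e | e \<in> E \<and> l e = j. d e)"
      using x_label[of j] by simp
    then show ?thesis by (simp only: of_nat_eq_iff)
  qed
  moreover have "p * card {e\<in>I. c e = i \<and> b e = \<beta>} < (\<Sum>e | e \<in> E \<and> c e = i \<and> b e = \<beta>. d e) + p" for i \<beta>
  proof (cases "(i, \<beta>) \<in> blk ` E")
    case True
    let ?S = "\<Sum>e | e \<in> E \<and> blk e = (i, \<beta>). d e"
    have "y (Inr (i, \<beta>)) \<le> \<lceil>x (Inr (i, \<beta>))\<rceil>" using y(1)[of "Inr (i, \<beta>)"] True by (auto simp: A_def)
    then have "real_of_int (y (Inr (i, \<beta>))) < x (Inr (i, \<beta>)) + 1" by linarith
    then have "real (card {e\<in>I. blk e = (i, \<beta>)}) < ?S / p + 1"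
      using y_block[OF True] by (simp add: x_def)
    then have "p * real (card {e\<in>I. blk e = (i, \<beta>)}) < ?S + p"
      using \<open>p > 0\<close> by (simp add: field_simps)
    then have "p * card {e\<in>I. blk e = (i, \<beta>)} < ?S + p"
      by (simp only: flip: of_nat_less_iff[where 'a = real] of_nat_add of_nat_mult)
    then show ?thesis by (simp add: blk_def)
  next
    case False
    then have none: "{e\<in>I. c e = i \<and> b e = \<beta>} = {}" by (auto simp: blk_def I_def)
    show ?thesis unfolding none using \<open>p > 0\<close> by simp
  qed
  moreover have "d e > 0" if "e \<in> I" for e using that y01[of e] by (auto simp: I_def)
  moreover have "I \<subseteq> E" by (auto simp: I_def)
  ultimately show ?thesis by (intro exI[of _ I] conjI ballI allI)
qed

section \<open>Fair detachments\<close>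

text \<open>Here \<open>C\<close> are the components of one colour, \<open>h \<kappa>\<close> counts
  the hinges of \<open>\<kappa>\<close> and \<open>t \<kappa>\<close> those that go to the new
  vertex. All components with \<open>t \<kappa> > 0\<close> merge into one, so the conclusion is the
  invariant \<open>t + p <= s * p + 1\<close> for the new count
  \<open>card {\<kappa>\<in>C. t \<kappa> = 0} + 1\<close> and \<open>p - 1\<close>.\<close>

lemma merge_count:
  fixes h t :: "'k \<Rightarrow> nat"
  assumes "finite C" "p > 0"
    and h: "\<And>\<kappa>. \<kappa> \<in> C \<Longrightarrow> h \<kappa> > 0"
    and fair: "\<And>\<kappa>. \<kappa> \<in> C \<Longrightarrow> p * t \<kappa> < h \<kappa> + p"
    and "sum h C = s * p" "sum t C = s" "card C + p \<le> s * p + 1"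
  shows "card {\<kappa>\<in>C. t \<kappa> = 0} + p \<le> s * (p - 1) + 1"
proof -
  define z where "z = (\<Sum>\<kappa>\<in>C. t \<kappa> - 1)"
  have "s + card {\<kappa>\<in>C. t \<kappa> = 0} = (\<Sum>\<kappa>\<in>C. t \<kappa> + of_bool (t \<kappa> = 0))"
    using \<open>finite C\<close> \<open>sum t C = s\<close> by (simp add: sum.distrib of_bool_def sum.If_cases Collect_conj_eq)
  also have "\<dots> = (\<Sum>\<kappa>\<in>C. 1 + (t \<kappa> - 1))" by (intro sum.cong) auto
  finally have 1: "s + card {\<kappa>\<in>C. t \<kappa> = 0} = card C + z" by (simp add: z_def sum.distrib del: One_nat_def)
  have "card C + p * z = (\<Sum>\<kappa>\<in>C. 1 + p * (t \<kappa> - 1))"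
    unfolding sum.distrib by (simp add: z_def sum_distrib_left)
  also have "\<dots> \<le> sum h C"
  proof (rule sum_mono)
    fix \<kappa> assume "\<kappa> \<in> C"
    with h fair[of \<kappa>] have "h \<kappa> > 0" "p * t \<kappa> < h \<kappa> + p" by auto
    then show "1 + p * (t \<kappa> - 1) \<le> h \<kappa>" by (cases "t \<kappa>") auto
  qed
  finally have 2: "card C + p * z \<le> s * p" using assms by simp
  have 3: "card C + z + p \<le> s * p + 1"
  proof (cases z)
    case 0
    then show ?thesis using assms by simp
  next
    case (Suc z')
    obtain p' where p': "p = Suc p'" using \<open>p > 0\<close> gr0_implies_Suc by blast
    \<comment> \<open>This is \<open>(p - 1) * (z - 1) \<ge> 0\<close>.\<close>
    have "z + p \<le> p * z + 1" by (simp add: Suc p')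
    then show ?thesis using 2 by linarith
  qed
  obtain p' where "p = Suc p'" using \<open>p > 0\<close> gr0_implies_Suc by blast
  then show ?thesis using 1 3 by simp
qed

text \<open>A component with \<open>0 < t \<kappa>\<close> and
  \<open>t \<kappa> < h \<kappa>\<close> is touched by the new vertex and keeps a hinge, so the
  merged component can still be joined to others by later splits.\<close>

lemma exists_split_component:
  fixes h t :: "'k \<Rightarrow> nat"
  assumes "finite C" "p \<ge> 2"
    and h: "\<And>\<kappa>. \<kappa> \<in> C \<Longrightarrow> h \<kappa> > 0"
    and fair: "\<And>\<kappa>. \<kappa> \<in> C \<Longrightarrow> p * t \<kappa> < h \<kappa> + p"
    and single: "p * sum t {\<kappa>\<in>C. h \<kappa> = 1} < sum h {\<kappa>\<in>C. h \<kappa> = 1} + p"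
    and "sum h C = s * p" "sum t C = s" "card C + p \<le> s * p + 1"
  shows "\<exists>\<kappa>\<in>C. 0 < t \<kappa> \<and> t \<kappa> < h \<kappa>"
proof (rule ccontr)
  assume no: "\<not> ?thesis"
  \<comment> \<open>Fairness forbids using up a component with two or more hinges:
    \<open>p * h < h + p\<close> says \<open>(p - 1) * (h - 1) < 1\<close>.\<close>
  have big: "t \<kappa> = 0" if \<kappa>: "\<kappa> \<in> C" "h \<kappa> \<noteq> 1" for \<kappa>
  proof (rule ccontr)
    assume "t \<kappa> \<noteq> 0"
    with no \<kappa> have "h \<kappa> \<le> t \<kappa>" by auto
    then have "p * h \<kappa> \<le> p * t \<kappa>" by simp
    then have "p * h \<kappa> < h \<kappa> + p" using fair[OF \<kappa>(1)] by linarith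
    moreover obtain a where "h \<kappa> = a + 2" using h[OF \<kappa>(1)] \<kappa>(2) by (metis One_nat_def Suc_1 add.commute le_add_diff_inverse less_2_cases_iff not_gr_zero not_less)
    moreover obtain a' where "p = a' + 2" using \<open>p \<ge> 2\<close> by (metis add.commute le_add_diff_inverse)
    ultimately show False by simp
  qed
  have "sum t {\<kappa>\<in>C. h \<kappa> = 1} = sum t C"
    using big \<open>finite C\<close> by (intro sum.mono_neutral_left) auto
  moreover have "sum h {\<kappa>\<in>C. h \<kappa> = 1} = card {\<kappa>\<in>C. h \<kappa> = 1}" by simp
  ultimately have "p * s < card {\<kappa>\<in>C. h \<kappa> = 1} + p" using single assms by simp
  \<comment> \<open>If the new vertex used single-hinge components only, the bound on their pooled
    share would make them at least as many as the invariant allows components in all. Then every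
    component has one hinge, and \<open>card C = s * p\<close> breaks the invariant because
    \<open>p \<ge> 2\<close>.\<close>
  then have "card C \<le> card {\<kappa>\<in>C. h \<kappa> = 1}" using assms(8) by (simp add: mult.commute)
  then have "{\<kappa>\<in>C. h \<kappa> = 1} = C" using \<open>finite C\<close> by (intro card_seteq) auto
  then have "sum h C = card C" using \<open>sum h {\<kappa>\<in>C. h \<kappa> = 1} = _\<close> by simp
  then show False using assms by simp
qed

text \<open>Connectedness of an edge set F in which edges with the same K-value count as connected in
  advance and all others are connected through common elements of their T-values.\<close>
definition linked :: "('e \<Rightarrow> 'k) \<Rightarrow> ('e \<Rightarrow> 'v set) \<Rightarrow> 'e set \<Rightarrow> bool" where
  "linked K T F \<longleftrightarrow> (\<forall>A\<subseteq>F. A \<noteq> {} \<longrightarrow>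
     (\<forall>e\<in>A. \<forall>e'\<in>F. K e = K e' \<or> T e \<inter> T e' \<noteq> {} \<longrightarrow> e' \<in> A) \<longrightarrow> A = F)"

text \<open>The set U is amalgamated to one vertex: T e consists of the vertices of e that are already split
  off (they lie in S), and e meets the amalgamated vertex k (g e) - card (T e) times.\<close>
lemma fair_distribution:
  fixes T :: "'e \<Rightarrow> 'v set" and g :: "'e \<Rightarrow> 'l" and c :: "'e \<Rightarrow> 'c" and K :: "'e \<Rightarrow> 'k"
    and k \<mu> :: "'l \<Rightarrow> nat" and D :: "'c \<Rightarrow> nat"
  assumes "finite U" "finite E" "finite S" "S \<inter> U = {}" "J \<subseteq> c ` E"
    and "\<And>e. e \<in> E \<Longrightarrow> T e \<subseteq> S \<and> card (T e) \<le> k (g e)"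
    and "\<And>l X. X \<subseteq> S \<Longrightarrow> card X \<le> k l \<Longrightarrow>
      card {e\<in>E. g e = l \<and> T e = X} = \<mu> l * (card U choose (k l - card X))"
    and "\<And>i. i \<in> c ` E \<Longrightarrow> (\<Sum>e | e \<in> E \<and> c e = i. k (g e) - card (T e)) = D i * card U"
    and "\<And>i. i \<in> J \<Longrightarrow> card (K ` {e\<in>E. c e = i}) + card U \<le> D i * card U + 1"
    and "\<And>e. U \<noteq> {} \<Longrightarrow> e \<in> E \<Longrightarrow> c e \<in> J \<Longrightarrow>
      \<exists>e'\<in>E. c e' = c e \<and> K e' = K e \<and> card (T e') < k (g e')"
  shows "\<exists>T'. (\<forall>e\<in>E. T e \<subseteq> T' e \<and> T' e \<subseteq> T e \<union> U \<and> card (T' e) = k (g e)) \<and>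
    (\<forall>l X. X \<subseteq> S \<union> U \<longrightarrow> card X = k l \<longrightarrow> card {e\<in>E. g e = l \<and> T' e = X} = \<mu> l) \<and>
    (\<forall>i\<in>c ` E. \<forall>u\<in>U. card {e\<in>E. c e = i \<and> u \<in> T' e} = D i) \<and>
    (\<forall>i\<in>J. linked K T' {e\<in>E. c e = i})"
  using assms(1,3,4,6-)
proof (induction U arbitrary: S T K rule: finite_induct)
  case empty
  \<comment> \<open>With no vertices left the prescribed count is
    \<open>0 choose (k (g e) - card (T e))\<close>, which vanishes unless \<open>e\<close> is
    complete.\<close>
  have full: "card (T e) = k (g e)" if "e \<in> E" for e
  proof (rule ccontr)
    assume "card (T e) \<noteq> k (g e)"
    moreover have "card {e'\<in>E. g e' = g e \<and> T e' = T e} = \<mu> (g e) * (0 choose (k (g e) - card (T e)))"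
      using empty.prems(3)[OF that] empty.prems(4)[of "T e" "g e"] by simp
    ultimately have "card {e'\<in>E. g e' = g e \<and> T e' = T e} = 0"
      using empty.prems(3)[OF that] by simp
    then show False using that \<open>finite E\<close> by auto
  qed
  have "linked K T {e\<in>E. c e = i}" if "i \<in> J" for i
  proof -
    have "card (K ` {e\<in>E. c e = i}) \<le> 1" using empty.prems(6)[OF that] by simp
    then have "\<forall>x\<in>K ` {e\<in>E. c e = i}. \<forall>y\<in>K ` {e\<in>E. c e = i}. x = y"
      using \<open>finite E\<close> by (intro card_le_Suc0_iff_eq[THEN iffD1]) auto
    then have "K e = K e'" if "e \<in> {e\<in>E. c e = i}" "e' \<in> {e\<in>E. c e = i}" for e e'
      using that imageI[of _ "{e\<in>E. c e = i}" K] by blast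
    then show ?thesis unfolding linked_def by blast
  qed
  with full empty.prems(4) show ?case by (intro exI[of _ T]) (auto simp: full)
next
  case (insert v U)
  note T = insert.prems(3) and count = insert.prems(4) and color = insert.prems(5)
  define p where "p = card (insert v U)"
  have p: "p = Suc (card U)" using insert.hyps by (simp add: p_def)
  define d where "d e = k (g e) - card (T e)" for e
  have fin_T: "finite (T e)" if "e \<in> E" for e using T[OF that] \<open>finite S\<close> finite_subset by blast
  have v_T: "v \<notin> T e" if "e \<in> E" for e using T[OF that] insert.prems(2) by auto
  \<comment> \<open>An edge with more than \<open>p\<close> hinges would belong to a class of
    prescribed size 0. The bound guarantees that no vertex has to enter an edge twice.\<close>
  have d_le: "d e \<le> p" if "e \<in> E" for e
  proof (rule ccontr)
    assume "\<not> d e \<le> p"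
    then have "p choose (k (g e) - card (T e)) = 0" by (simp add: d_def)
    then have "card {e'\<in>E. g e' = g e \<and> T e' = T e} = 0"
      using count[of "T e" "g e"] T[OF that] by (simp add: p_def)
    then show False using that \<open>finite E\<close> by auto
  qed
  \<comment> \<open>The absorption identity for binomial coefficients exhibits the factor
    \<open>p\<close>. The case distinction keeps truncated subtraction from turning
    \<open>0 - 1\<close> into a spurious binomial coefficient.\<close>
  have label_sum: "(\<Sum>e | e \<in> E \<and> g e = l \<and> T e = X. d e)
      = p * (\<mu> l * (if k l - card X = 0 then 0 else card U choose (k l - card X - 1)))"
    if "X \<subseteq> S" "card X \<le> k l" for l X
  proof -
    have "(\<Sum>e | e \<in> E \<and> g e = l \<and> T e = X. d e) = (\<Sum>e | e \<in> E \<and> g e = l \<and> T e = X. k l - card X)"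
      by (intro sum.cong) (auto simp: d_def)
    also have "\<dots> = \<mu> l * ((k l - card X) * (p choose (k l - card X)))"
      using count[OF that] by (simp add: p_def)
    finally show ?thesis using times_binomial_minus1_eq[of "k l - card X" p] p
      by (cases "k l - card X") (simp_all add: mult.left_commute)
  qed
  have label_none: "{e\<in>E. g e = l \<and> T e = X} = {}" if "\<not> (X \<subseteq> S \<and> card X \<le> k l)" for l X
    using T that by blast
  define h where "h i \<kappa> = (\<Sum>e | e \<in> E \<and> c e = i \<and> K e = \<kappa>. d e)" for i \<kappa>
  define b where "b e = (if h (c e) (K e) = 1 then None else Some (K e))" for e
  \<comment> \<open>All components with a single hinge share one block. Its fair share stays below the degree, so
    the new vertex also meets a component with further hinges and remains attached through it.\<close>
  have "\<exists>I\<subseteq>E. (\<forall>e\<in>I. d e > 0) \<and> (\<forall>i\<in>c ` E. card {e\<in>I. c e = i} = D i) \<and>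
    (\<forall>j. p * card {e\<in>I. (g e, T e) = j} = (\<Sum>e | e \<in> E \<and> (g e, T e) = j. d e)) \<and>
    (\<forall>i \<beta>. p * card {e\<in>I. c e = i \<and> b e = \<beta>} < (\<Sum>e | e \<in> E \<and> c e = i \<and> b e = \<beta>. d e) + p)"
  proof (rule fair_selection[OF \<open>finite E\<close>])
    fix j show "p dvd (\<Sum>e | e \<in> E \<and> (g e, T e) = j. d e)"
    proof (cases j)
      case (Pair l X)
      show ?thesis
      proof (cases "X \<subseteq> S \<and> card X \<le> k l")
        case True
        then have "p dvd (\<Sum>e | e \<in> E \<and> g e = l \<and> T e = X. d e)" using label_sum[of X l] by simp
        then show ?thesis using Pair by simp
      next
        case False
        have none: "{e. e \<in> E \<and> (g e, T e) = j} = {}" using label_none[OF False] Pair by auto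
        show ?thesis unfolding none by simp
      qed
    qed
  qed (use p d_le color in \<open>auto simp: p_def d_def\<close>)
  then obtain I where I: "I \<subseteq> E" and I_d: "\<And>e. e \<in> I \<Longrightarrow> d e > 0"
    and I_color: "\<And>i. i \<in> c ` E \<Longrightarrow> card {e\<in>I. c e = i} = D i"
    and I_label: "\<And>l X. p * card {e\<in>I. g e = l \<and> T e = X} = (\<Sum>e | e \<in> E \<and> g e = l \<and> T e = X. d e)"
    and I_block: "\<And>i \<beta>. p * card {e\<in>I. c e = i \<and> b e = \<beta>} < (\<Sum>e | e \<in> E \<and> c e = i \<and> b e = \<beta>. d e) + p"
    by auto
  have "finite I" using I \<open>finite E\<close> finite_subset by blast
  define T1 where "T1 e = (if e \<in> I then insert v (T e) else T e)" for e
  define t where "t i \<kappa> = card {e\<in>I. c e = i \<and> K e = \<kappa>}" for i \<kappa>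
  \<comment> \<open>The components met by \<open>v\<close> receive a common name. It is the name of
    one of them, so it cannot coincide with that of an untouched component.\<close>
  define K1 where "K1 e = (if t (c e) (K e) > 0 then SOME \<kappa>. t (c e) \<kappa> > 0 else K e)" for e
  have card_T1: "card (T1 e) = card (T e) + of_bool (e \<in> I)" if "e \<in> E" for e
    using fin_T[OF that] v_T[OF that] by (simp add: T1_def)
  have d1: "k (g e) - card (T1 e) + of_bool (e \<in> I) = d e" if "e \<in> E" for e
    using card_T1[OF that] I_d[of e] by (auto simp: d_def)
  have step_T: "T1 e \<subseteq> insert v S \<and> card (T1 e) \<le> k (g e)" if "e \<in> E" for e
    using T[OF that] card_T1[OF that] I_d[of e] by (auto simp: T1_def d_def)
  have I_count: "card {e\<in>I. g e = l \<and> T e = X}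
      = \<mu> l * (if k l - card X = 0 then 0 else card U choose (k l - card X - 1))"
    if "X \<subseteq> S" "card X \<le> k l" for l X
  proof -
    have "p > 0" using p by simp
    then show ?thesis
      using trans[OF I_label[of l X] label_sum[OF that]] by (simp only: nat_mult_eq_cancel1)
  qed
  \<comment> \<open>If \<open>v \<in> X\<close>, these are the selected edges, counted by
    \<open>I_count\<close>. Otherwise they are the edges of the old class that were not selected,
    and Pascal's rule performs the subtraction.\<close>
  have step_count: "card {e\<in>E. g e = l \<and> T1 e = X} = \<mu> l * (card U choose (k l - card X))"
    if X: "X \<subseteq> insert v S" "card X \<le> k l" for l X
  proof (cases "v \<in> X")
    case True
    define Y where "Y = X - {v}"
    have Y: "X = insert v Y" "v \<notin> Y" "Y \<subseteq> S" using X True by (auto simp: Y_def)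
    have "finite Y" using Y \<open>finite S\<close> finite_subset by blast
    then have cX: "card X = Suc (card Y)" using Y by simp
    have "T1 e = X \<longleftrightarrow> e \<in> I \<and> T e = Y" if "e \<in> E" for e
      using v_T[OF that] Y insert_ident[of v "T e" Y] by (cases "e \<in> I") (auto simp: T1_def)
    then have "{e\<in>E. g e = l \<and> T1 e = X} = {e\<in>I. g e = l \<and> T e = Y}"
      using I by auto
    then show ?thesis using I_count[of Y l] Y(3) X cX by (auto simp: Suc_diff_Suc)
  next
    case False
    then have XS: "X \<subseteq> S" using X by auto
    have "{e\<in>E. g e = l \<and> T e = X} = {e\<in>E. g e = l \<and> T1 e = X} \<union> {e\<in>I. g e = l \<and> T e = X}"
      using I False by (auto simp: T1_def)
    moreover have "{e\<in>E. g e = l \<and> T1 e = X} \<inter> {e\<in>I. g e = l \<and> T e = X} = {}"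
      using False by (auto simp: T1_def)
    ultimately have "card {e\<in>E. g e = l \<and> T e = X}
        = card {e\<in>E. g e = l \<and> T1 e = X} + card {e\<in>I. g e = l \<and> T e = X}"
      using \<open>finite E\<close> \<open>finite I\<close> by (simp add: card_Un_disjoint)
    then have eq: "\<mu> l * (p choose (k l - card X)) = card {e\<in>E. g e = l \<and> T1 e = X}
        + \<mu> l * (if k l - card X = 0 then 0 else card U choose (k l - card X - 1))"
      using count[OF XS X(2)] I_count[OF XS X(2)] by (simp add: p_def)
    show ?thesis
    proof (cases "k l - card X")
      case 0
      then show ?thesis using eq by simp
    next
      case (Suc r)
      then show ?thesis using eq p by (simp add: algebra_simps)
    qed
  qed
  have card_I: "card {e\<in>I. Q e} = (\<Sum>e | e \<in> E \<and> Q e. of_bool (e \<in> I))" for Q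
  proof -
    have "(\<Sum>e | e \<in> E \<and> Q e. of_bool (e \<in> I)) = card ({e\<in>E. Q e} \<inter> I)"
      using \<open>finite E\<close> by (simp add: of_bool_def sum.If_cases)
    also have "{e\<in>E. Q e} \<inter> I = {e\<in>I. Q e}" using I by auto
    finally show ?thesis by simp
  qed
  have step_color: "(\<Sum>e | e \<in> E \<and> c e = i. k (g e) - card (T1 e)) = D i * card U" if "i \<in> c ` E" for i
  proof -
    have "(\<Sum>e | e \<in> E \<and> c e = i. k (g e) - card (T1 e)) + (\<Sum>e | e \<in> E \<and> c e = i. of_bool (e \<in> I))
        = (\<Sum>e | e \<in> E \<and> c e = i. d e)"
      unfolding sum.distrib[symmetric] using d1 by (intro sum.cong) auto
    then show ?thesis using I_color[OF that] color[OF that] card_I[of "\<lambda>e. c e = i"] p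
      by (simp add: d_def p_def)
  qed
  have group: "(\<Sum>\<kappa> | \<kappa> \<in> K ` {e\<in>E. c e = i} \<and> Q \<kappa>. \<Sum>e | e \<in> E \<and> c e = i \<and> K e = \<kappa>. w e)
      = (\<Sum>e | e \<in> E \<and> c e = i \<and> Q (K e). w e)" for w :: "'e \<Rightarrow> nat" and i Q
  proof -
    have "(\<Sum>\<kappa> | \<kappa> \<in> K ` {e\<in>E. c e = i} \<and> Q \<kappa>. \<Sum>e | e \<in> E \<and> c e = i \<and> K e = \<kappa>. w e)
        = (\<Sum>\<kappa> | \<kappa> \<in> K ` {e\<in>E. c e = i} \<and> Q \<kappa>. \<Sum>e | e \<in> {e\<in>E. c e = i \<and> Q (K e)} \<and> K e = \<kappa>. w e)"
      by (intro sum.cong) auto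
    also have "\<dots> = (\<Sum>e | e \<in> E \<and> c e = i \<and> Q (K e). w e)"
      using \<open>finite E\<close> by (intro sum.group) auto
    finally show ?thesis .
  qed
  have sum_h: "(\<Sum>\<kappa> | \<kappa> \<in> K ` {e\<in>E. c e = i} \<and> Q \<kappa>. h i \<kappa>) = (\<Sum>e | e \<in> E \<and> c e = i \<and> Q (K e). d e)" for i Q
    unfolding h_def by (rule group)
  have sum_t: "(\<Sum>\<kappa> | \<kappa> \<in> K ` {e\<in>E. c e = i} \<and> Q \<kappa>. t i \<kappa>) = card {e\<in>I. c e = i \<and> Q (K e)}" for i Q
    unfolding t_def card_I by (rule group)
  have t_pos: "t (c e) (K e) > 0" if "e \<in> I" for e
    using that \<open>finite I\<close> by (auto simp: t_def card_gt_0_iff)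
  have step_J: "card (K1 ` {e\<in>E. c e = i}) + card U \<le> D i * card U + 1 \<and>
      (U \<noteq> {} \<longrightarrow> (\<forall>e\<in>E. c e = i \<longrightarrow> (\<exists>e'\<in>E. c e' = c e \<and> K1 e' = K1 e \<and> card (T1 e') < k (g e'))))"
    if "i \<in> J" for i
  proof -
    have iE: "i \<in> c ` E" using that \<open>J \<subseteq> c ` E\<close> by blast
    define C where "C = K ` {e\<in>E. c e = i}"
    have "finite C" using \<open>finite E\<close> by (simp add: C_def)
    have h_pos: "h i \<kappa> > 0" if \<kappa>: "\<kappa> \<in> C" for \<kappa>
    proof -
      obtain e where "e \<in> E" "c e = i" "K e = \<kappa>" using \<kappa> by (auto simp: C_def)
      with insert.prems(7)[of e] \<open>i \<in> J\<close> obtain e' where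
        "e' \<in> E" "c e' = i" "K e' = \<kappa>" "card (T e') < k (g e')" by auto
      then have "e' \<in> {e. e \<in> E \<and> c e = i \<and> K e = \<kappa>}" "d e' > 0" by (auto simp: d_def)
      then show ?thesis using \<open>finite E\<close> unfolding h_def by (intro sum_pos2[of _ e']) auto
    qed
    \<comment> \<open>A single-hinge component has no block of its own, but there the bound is
      trivial since \<open>t i \<kappa> \<le> 1\<close>.\<close>
    have fair: "p * t i \<kappa> < h i \<kappa> + p" if \<kappa>: "\<kappa> \<in> C" for \<kappa>
    proof (cases "h i \<kappa> = 1")
      case True
      have "t i \<kappa> \<le> (\<Sum>e | e \<in> E \<and> c e = i \<and> K e = \<kappa>. d e)"
        unfolding t_def card_I using I_d by (intro sum_mono) (auto simp: Suc_le_eq)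
      then have "t i \<kappa> \<le> 1" using True by (simp add: h_def)
      then have "p * t i \<kappa> \<le> p * 1" by (rule mult_le_mono2)
      then show ?thesis using True by linarith
    next
      case False
      have "c e = i \<and> b e = Some \<kappa> \<longleftrightarrow> c e = i \<and> K e = \<kappa>" for e using False by (auto simp: b_def)
      then show ?thesis using I_block[of i "Some \<kappa>"] by (simp add: t_def h_def)
    qed
    have "c e = i \<and> b e = None \<longleftrightarrow> c e = i \<and> h i (K e) = 1" for e by (auto simp: b_def)
    then have single: "p * sum (t i) {\<kappa>\<in>C. h i \<kappa> = 1} < sum (h i) {\<kappa>\<in>C. h i \<kappa> = 1} + p"
      using I_block[of i None] unfolding C_def sum_t sum_h by simp
    have total_h: "sum (h i) C = D i * p"
      using sum_h[of i "\<lambda>_. True"] color[OF iE] by (simp add: C_def d_def p_def)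
    have total_t: "sum (t i) C = D i"
      using sum_t[of i "\<lambda>_. True"] I_color[OF iE] by (simp add: C_def)
    have inv: "card C + p \<le> D i * p + 1" using insert.prems(6)[OF that] by (simp add: C_def p_def)
    have "K1 ` {e\<in>E. c e = i} \<subseteq> insert (SOME \<kappa>. t i \<kappa> > 0) {\<kappa>\<in>C. t i \<kappa> = 0}"
      by (auto simp: K1_def C_def)
    then have "card (K1 ` {e\<in>E. c e = i}) \<le> card (insert (SOME \<kappa>. t i \<kappa> > 0) {\<kappa>\<in>C. t i \<kappa> = 0})"
      using \<open>finite C\<close> by (intro card_mono) auto
    also have "\<dots> \<le> Suc (card {\<kappa>\<in>C. t i \<kappa> = 0})" using \<open>finite C\<close> by (intro card_insert_le_m1) auto
    finally have 1: "card (K1 ` {e\<in>E. c e = i}) + card U \<le> D i * card U + 1"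
      using merge_count[OF \<open>finite C\<close> _ h_pos fair total_h total_t inv] p by simp
    have "\<exists>e'\<in>E. c e' = c e \<and> K1 e' = K1 e \<and> card (T1 e') < k (g e')"
      if U: "U \<noteq> {}" and e: "e \<in> E" "c e = i" for e
    proof (cases "t i (K e) > 0")
      case True
      have "p \<ge> 2" using U p insert.hyps by (simp add: Suc_le_eq card_gt_0_iff)
      \<comment> \<open>All touched components now carry one \<open>K1\<close> name, so one edge
        with a hinge left, in any of them, serves every edge of the merged component.\<close>
      with exists_split_component[OF \<open>finite C\<close> _ h_pos fair single total_h total_t inv]
      obtain \<kappa> where \<kappa>: "\<kappa> \<in> C" "0 < t i \<kappa>" "t i \<kappa> < h i \<kappa>" by blast
      have "\<exists>e'\<in>E. c e' = i \<and> K e' = \<kappa> \<and> card (T1 e') < k (g e')"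
      proof (rule ccontr)
        assume no: "\<not> ?thesis"
        have "h i \<kappa> = (\<Sum>e | e \<in> E \<and> c e = i \<and> K e = \<kappa>. of_bool (e \<in> I))"
          unfolding h_def
        proof (rule sum.cong)
          fix e assume e: "e \<in> {e. e \<in> E \<and> c e = i \<and> K e = \<kappa>}"
          then have "k (g e) - card (T1 e) = 0" using no by auto
          then show "d e = of_bool (e \<in> I)" using d1[of e] e by simp
        qed simp
        then show False using \<kappa> by (simp add: t_def card_I)
      qed
      then obtain e' where "e' \<in> E" "c e' = i" "K e' = \<kappa>" "card (T1 e') < k (g e')" by blast
      then show ?thesis using True \<kappa> e by (intro bexI[of _ e']) (auto simp: K1_def)
    next
      \<comment> \<open>An untouched component loses no hinge, so the old witness remains
        valid.\<close>
      case False
      obtain e' where e': "e' \<in> E" "c e' = i" "K e' = K e" "card (T e') < k (g e')"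
        using insert.prems(7)[OF _ e(1)] e \<open>i \<in> J\<close> by auto
      then have "e' \<notin> I" using t_pos[of e'] False by auto
      then show ?thesis using e' e False by (intro bexI[of _ e']) (auto simp: K1_def T1_def)
    qed
    with 1 show ?thesis by blast
  qed
  have "\<exists>T'. (\<forall>e\<in>E. T1 e \<subseteq> T' e \<and> T' e \<subseteq> T1 e \<union> U \<and> card (T' e) = k (g e)) \<and>
    (\<forall>l X. X \<subseteq> insert v S \<union> U \<longrightarrow> card X = k l \<longrightarrow> card {e\<in>E. g e = l \<and> T' e = X} = \<mu> l) \<and>
    (\<forall>i\<in>c ` E. \<forall>u\<in>U. card {e\<in>E. c e = i \<and> u \<in> T' e} = D i) \<and>
    (\<forall>i\<in>J. linked K1 T' {e\<in>E. c e = i})"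
  proof (rule insert.IH)
    show "finite (insert v S)" using insert.prems by simp
    show "insert v S \<inter> U = {}" using insert.prems insert.hyps by auto
    show "\<And>i. i \<in> J \<Longrightarrow> card (K1 ` {e\<in>E. c e = i}) + card U \<le> D i * card U + 1"
      using step_J by blast
    show "\<And>e. U \<noteq> {} \<Longrightarrow> e \<in> E \<Longrightarrow> c e \<in> J \<Longrightarrow>
      \<exists>e'\<in>E. c e' = c e \<and> K1 e' = K1 e \<and> card (T1 e') < k (g e')"
      using step_J by blast
  qed (fact step_T step_count step_color)+
  then obtain T' where T': "\<forall>e\<in>E. T1 e \<subseteq> T' e \<and> T' e \<subseteq> T1 e \<union> U \<and> card (T' e) = k (g e)"
    and T'_count: "\<forall>l X. X \<subseteq> insert v S \<union> U \<longrightarrow> card X = k l \<longrightarrow> card {e\<in>E. g e = l \<and> T' e = X} = \<mu> l"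
    and T'_deg: "\<forall>i\<in>c ` E. \<forall>u\<in>U. card {e\<in>E. c e = i \<and> u \<in> T' e} = D i"
    and T'_linked: "\<forall>i\<in>J. linked K1 T' {e\<in>E. c e = i}"
    by (elim exE conjE) (rule that)
  have v_T': "v \<in> T' e \<longleftrightarrow> e \<in> I" if "e \<in> E" for e
    using bspec[OF T' that] v_T[OF that] insert.hyps by (auto simp: T1_def split: if_splits)
  have "\<forall>e\<in>E. T e \<subseteq> T' e \<and> T' e \<subseteq> T e \<union> insert v U \<and> card (T' e) = k (g e)"
    using T' by (auto simp: T1_def split: if_splits)
  moreover have "\<forall>l X. X \<subseteq> S \<union> insert v U \<longrightarrow> card X = k l \<longrightarrow> card {e\<in>E. g e = l \<and> T' e = X} = \<mu> l"
    using T'_count by simp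
  moreover have "card {e\<in>E. c e = i \<and> u \<in> T' e} = D i" if "i \<in> c ` E" "u \<in> insert v U" for i u
  proof (cases "u = v")
    case True
    have "{e\<in>E. c e = i \<and> v \<in> T' e} = {e\<in>I. c e = i}" using v_T' I by auto
    then show ?thesis using I_color[OF that(1)] True by simp
  qed (use that T'_deg in auto)
  moreover have "linked K T' {e\<in>E. c e = i}" if "i \<in> J" for i
    unfolding linked_def
  proof (intro allI impI)
    fix A assume A: "A \<subseteq> {e\<in>E. c e = i}" "A \<noteq> {}"
      and closed: "\<forall>e\<in>A. \<forall>e'\<in>{e\<in>E. c e = i}. K e = K e' \<or> T' e \<inter> T' e' \<noteq> {} \<longrightarrow> e' \<in> A"
    \<comment> \<open>Closure under \<open>K1\<close> reduces to closure under \<open>K\<close> and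
      \<open>T'\<close>: two merged components each contain an edge through \<open>v\<close>, and
      these two edges overlap in \<open>v\<close>.\<close>
    have "e' \<in> A" if e: "e \<in> A" "e' \<in> E" "c e' = i" "K1 e = K1 e'" for e e'
    proof -
      have some: "t i (SOME \<kappa>. t i \<kappa> > 0) > 0" if "t i \<kappa> > 0" for \<kappa> using that by (rule someI)
      have "c e = i" using e A by auto
      consider "K e = K e'" | "t i (K e) > 0" "t i (K e') > 0"
        using e some \<open>c e = i\<close> by (auto simp: K1_def split: if_splits)
      then show "e' \<in> A"
      proof cases
        case 1
        then show ?thesis using closed e by blast
      next
        case 2
        then obtain f f' where f: "f \<in> I" "c f = i" "K f = K e" "f' \<in> I" "c f' = i" "K f' = K e'"
          unfolding t_def card_gt_0_iff by blast
        then have "f \<in> E" "f' \<in> E" using I by auto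
        then have "v \<in> T' f \<inter> T' f'" using f v_T' by simp
        have "f \<in> A" using closed e f \<open>f \<in> E\<close> by (metis (mono_tags, lifting) mem_Collect_eq)
        then have "f' \<in> A" using closed f \<open>f' \<in> E\<close> \<open>v \<in> T' f \<inter> T' f'\<close> by blast
        then show ?thesis using closed e f by blast
      qed
    qed
    with closed have "\<forall>e\<in>A. \<forall>e'\<in>{e\<in>E. c e = i}. K1 e = K1 e' \<or> T' e \<inter> T' e' \<noteq> {} \<longrightarrow> e' \<in> A" by blast
    with bspec[OF T'_linked that] A show "A = {e\<in>E. c e = i}" unfolding linked_def by blast
  qed
  ultimately show ?case by (intro exI[of _ T'] conjI) (assumption | intro ballI)+
qed

text \<open>The starting position of the induction: nothing is split off yet, and
  \<open>K = id\<close> makes each edge its own component. Positivity of \<open>k\<close> on the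
  colours in \<open>J\<close> supplies the initial hinge of every component.\<close>

lemma fair_detachment:
  fixes g :: "'e \<Rightarrow> 'l" and c :: "'e \<Rightarrow> 'c" and k \<mu> :: "'l \<Rightarrow> nat" and D :: "'c \<Rightarrow> nat" and U :: "'v set"
  assumes "finite U" "finite E" "J \<subseteq> c ` E"
    and "\<And>l. card {e\<in>E. g e = l} = \<mu> l * (card U choose k l)"
    and "\<And>i. i \<in> c ` E \<Longrightarrow> (\<Sum>e | e \<in> E \<and> c e = i. k (g e)) = D i * card U"
    and "\<And>i. i \<in> J \<Longrightarrow> card {e\<in>E. c e = i} + card U \<le> D i * card U + 1"
    and "\<And>e. e \<in> E \<Longrightarrow> c e \<in> J \<Longrightarrow> k (g e) > 0"
  obtains T where "\<And>e. e \<in> E \<Longrightarrow> T e \<subseteq> U" "\<And>e. e \<in> E \<Longrightarrow> card (T e) = k (g e)"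
    "\<And>l X. X \<subseteq> U \<Longrightarrow> card X = k l \<Longrightarrow> card {e\<in>E. g e = l \<and> T e = X} = \<mu> l"
    "\<And>i u. i \<in> c ` E \<Longrightarrow> u \<in> U \<Longrightarrow> card {e\<in>E. c e = i \<and> u \<in> T e} = D i"
    "\<And>i. i \<in> J \<Longrightarrow> linked id T {e\<in>E. c e = i}"
proof -
  have "\<exists>T. (\<forall>e\<in>E. {} \<subseteq> T e \<and> T e \<subseteq> {} \<union> U \<and> card (T e) = k (g e)) \<and>
    (\<forall>l X. X \<subseteq> {} \<union> U \<longrightarrow> card X = k l \<longrightarrow> card {e\<in>E. g e = l \<and> T e = X} = \<mu> l) \<and>
    (\<forall>i\<in>c ` E. \<forall>u\<in>U. card {e\<in>E. c e = i \<and> u \<in> T e} = D i) \<and>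
    (\<forall>i\<in>J. linked id T {e\<in>E. c e = i})"
    using assms by (intro fair_distribution) auto
  then obtain T where "\<forall>e\<in>E. {} \<subseteq> T e \<and> T e \<subseteq> {} \<union> U \<and> card (T e) = k (g e)"
    "\<forall>l X. X \<subseteq> {} \<union> U \<longrightarrow> card X = k l \<longrightarrow> card {e\<in>E. g e = l \<and> T e = X} = \<mu> l"
    "\<forall>i\<in>c ` E. \<forall>u\<in>U. card {e\<in>E. c e = i \<and> u \<in> T e} = D i"
    "\<forall>i\<in>J. linked id T {e\<in>E. c e = i}"
    by (elim exE conjE)
  then show ?thesis by (intro that[of T]) blast+
qed

section \<open>Colouring the new edges by two successive detachments\<close>

text \<open>The numbers \<open>x i a\<close> define abstract edges that know only their colour and
  type. Detaching the \<open>W\<close> side and then the \<open>N\<close> side gives each of them a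
  vertex set, with every set in \<open>Y\<close> obtained exactly \<open>lam\<close> times, so the
  colours can be carried over to the labelled edges.\<close>

lemma two_class_colouring:
  fixes W N :: "'a set" and x :: "nat \<Rightarrow> nat \<Rightarrow> nat" and D :: "nat \<Rightarrow> nat"
  assumes fin: "finite W" "finite N" "W \<inter> N = {}" and "N \<noteq> {}" "s > 0"
    and type: "\<And>a. a < h \<Longrightarrow> (\<Sum>i<\<kappa>. x i a) = lam * (card W choose a) * (card N choose (h - a))"
    and deg_W: "\<And>i. i < \<kappa> \<Longrightarrow> (\<Sum>a<h. x i a * a) = D i * card W"
    and deg_N: "\<And>i. i < \<kappa> \<Longrightarrow> (\<Sum>a<h. x i a * (h - a)) = s * card N"
    and conn: "\<And>i. i < \<kappa> \<Longrightarrow> (\<Sum>a<h. x i a) + card N \<le> s * card N + 1"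
  defines "Y \<equiv> nsets (W \<union> N) h - nsets W h"
  obtains col :: "'a set \<times> nat \<Rightarrow> nat" where
    "\<And>y. y \<in> Y \<times> {..<lam} \<Longrightarrow> col y < \<kappa>"
    "\<And>i w. i < \<kappa> \<Longrightarrow> w \<in> W \<Longrightarrow> card {y \<in> Y \<times> {..<lam}. col y = i \<and> w \<in> fst y} = D i"
    "\<And>i v. i < \<kappa> \<Longrightarrow> v \<in> N \<Longrightarrow> card {y \<in> Y \<times> {..<lam}. col y = i \<and> v \<in> fst y} = s"
    "\<And>i. i < \<kappa> \<Longrightarrow> linked id (\<lambda>y. fst y \<inter> N) {y \<in> Y \<times> {..<lam}. col y = i}"
proof -
  \<comment> \<open>A triple consists of the colour, the number of vertices in \<open>W\<close> and
    a serial number.\<close>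
  define E where "E = (SIGMA i:{..<\<kappa>}. SIGMA a:{..<h}. {..<x i a})"
  define c :: "nat \<times> nat \<times> nat \<Rightarrow> nat" where "c = fst"
  define a :: "nat \<times> nat \<times> nat \<Rightarrow> nat" where "a = (\<lambda>e. fst (snd e))"
  have "finite E" by (simp add: E_def)
  have a_less: "a e < h" and c_less: "c e < \<kappa>" if "e \<in> E" for e using that by (auto simp: E_def a_def c_def)
  have sum_E: "(\<Sum>e | e \<in> E \<and> c e = i. f (a e)) = (\<Sum>b<h. x i b * f b)" if "i < \<kappa>" for i and f :: "nat \<Rightarrow> nat"
  proof -
    have "{e. e \<in> E \<and> c e = i} = Pair i ` (SIGMA b:{..<h}. {..<x i b})" using that by (auto simp: E_def c_def)
    then have "(\<Sum>e | e \<in> E \<and> c e = i. f (a e)) = (\<Sum>(b, j)\<in>(SIGMA b:{..<h}. {..<x i b}). f b)"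
      by (simp add: sum.reindex inj_on_def a_def case_prod_beta)
    also have "\<dots> = (\<Sum>b<h. x i b * f b)" by (subst sum.Sigma[symmetric]) simp_all
    finally show ?thesis .
  qed
  have card_E: "card {e\<in>E. c e = i} = (\<Sum>b<h. x i b)" if "i < \<kappa>" for i
    using sum_E[OF that, of "\<lambda>_. 1"] by simp
  have "c ` E = {..<\<kappa>}"
  proof
    show "{..<\<kappa>} \<subseteq> c ` E"
    proof
      fix i assume "i \<in> {..<\<kappa>}"
      then have "(\<Sum>e | e \<in> E \<and> c e = i. h - a e) = s * card N" using sum_E[of i "\<lambda>b. h - b"] deg_N by simp
      moreover have "s * card N > 0" using fin \<open>N \<noteq> {}\<close> \<open>s > 0\<close> by (simp add: card_gt_0_iff)
      ultimately have "{e. e \<in> E \<and> c e = i} \<noteq> {}" by (metis less_irrefl sum.empty)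
      then show "i \<in> c ` E" by auto
    qed
  qed (use c_less in auto)
  have count_a: "card {e\<in>E. a e = b} = (if b < h then lam * (card N choose (h - b)) else 0) * (card W choose b)" for b
  proof (cases "b < h")
    case True
    have "{e\<in>E. a e = b} = (\<lambda>(i, j). (i, b, j)) ` (SIGMA i:{..<\<kappa>}. {..<x i b})"
      using True by (auto simp: E_def a_def image_iff)
    then have "card {e\<in>E. a e = b} = card (SIGMA i:{..<\<kappa>}. {..<x i b})"
      by (simp add: card_image inj_on_def)
    then show ?thesis using type[OF True] True by simp
  next
    case False
    then have none: "{e\<in>E. a e = b} = {}" using a_less by fastforce
    show ?thesis unfolding none using False by simp
  qed
  \<comment> \<open>Labels are the types here. Each \<open>b\<close>-subset of \<open>W\<close> has
    to occur once for every copy of every \<open>(h - b)\<close>-subset of \<open>N\<close>, whence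
    the multiplicity. It is 0 from \<open>h\<close> on because edges inside \<open>W\<close> belong
    to the given factors. No connectedness is asked for (\<open>J\<close> is empty).\<close>
  obtain T1 where T1: "\<And>e. e \<in> E \<Longrightarrow> T1 e \<subseteq> W" "\<And>e. e \<in> E \<Longrightarrow> card (T1 e) = a e"
    and T1_count: "\<And>b X. X \<subseteq> W \<Longrightarrow> card X = b \<Longrightarrow>
      card {e\<in>E. a e = b \<and> T1 e = X} = (if b < h then lam * (card N choose (h - b)) else 0)"
    and T1_deg: "\<And>i w. i \<in> c ` E \<Longrightarrow> w \<in> W \<Longrightarrow> card {e\<in>E. c e = i \<and> w \<in> T1 e} = D i"
  proof (rule fair_detachment[OF \<open>finite W\<close> \<open>finite E\<close>, of "{}" c a
      "\<lambda>b. if b < h then lam * (card N choose (h - b)) else 0" "\<lambda>b. b" D])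
    show "(\<Sum>e | e \<in> E \<and> c e = i. a e) = D i * card W" if "i \<in> c ` E" for i
      using that \<open>c ` E = _\<close> sum_E[of i "\<lambda>b. b"] deg_W by simp
  qed (use count_a in auto)
  have T1_less: "card (T1 e) < h" if "e \<in> E" for e using T1(2)[OF that] a_less[OF that] by simp
  have count_T1: "card {e\<in>E. T1 e = X} = (if X \<subseteq> W \<and> card X < h then lam else 0) * (card N choose (h - card X))" for X
  proof (cases "X \<subseteq> W \<and> card X < h")
    case True
    have "{e\<in>E. T1 e = X} = {e\<in>E. a e = card X \<and> T1 e = X}" using T1(2) by auto
    then show ?thesis using T1_count[of X "card X"] True by simp
  next
    case False
    then have none: "{e\<in>E. T1 e = X} = {}" using T1(1) T1_less by blast
    show ?thesis unfolding none using False by auto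
  qed
  \<comment> \<open>The label of an edge is now its actual trace \<open>T1 e\<close> on
    \<open>W\<close>, so fairness over labels yields multiplicity \<open>lam\<close> for each pair
    of traces. All colours are kept connected.\<close>
  obtain T2 where T2: "\<And>e. e \<in> E \<Longrightarrow> T2 e \<subseteq> N" "\<And>e. e \<in> E \<Longrightarrow> card (T2 e) = h - card (T1 e)"
    and T2_count: "\<And>X Z. Z \<subseteq> N \<Longrightarrow> card Z = h - card X \<Longrightarrow>
      card {e\<in>E. T1 e = X \<and> T2 e = Z} = (if X \<subseteq> W \<and> card X < h then lam else 0)"
    and T2_deg: "\<And>i v. i \<in> c ` E \<Longrightarrow> v \<in> N \<Longrightarrow> card {e\<in>E. c e = i \<and> v \<in> T2 e} = s"
    and T2_linked: "\<And>i. i \<in> c ` E \<Longrightarrow> linked id T2 {e\<in>E. c e = i}"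
  proof (rule fair_detachment[OF \<open>finite N\<close> \<open>finite E\<close>, of "c ` E" c T1
      "\<lambda>X. if X \<subseteq> W \<and> card X < h then lam else 0" "\<lambda>X. h - card X" "\<lambda>_. s"])
    show "(\<Sum>e | e \<in> E \<and> c e = i. h - card (T1 e)) = s * card N" if "i \<in> c ` E" for i
      using that \<open>c ` E = _\<close> sum_E[of i "\<lambda>b. h - b"] deg_N T1(2) by simp
    show "card {e\<in>E. c e = i} + card N \<le> s * card N + 1" if "i \<in> c ` E" for i
      using that \<open>c ` E = _\<close> card_E conn by simp
  qed (use count_T1 T1_less in auto)
  define T where "T e = T1 e \<union> T2 e" for e
  have T_W: "T e \<inter> W = T1 e" and T_N: "T e \<inter> N = T2 e" if "e \<in> E" for e
    using T1(1)[OF that] T2(1)[OF that] \<open>W \<inter> N = {}\<close> by (auto simp: T_def)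
  have "card {e\<in>E. T e = X} = lam" if "X \<in> Y" for X
  proof -
    have X: "X \<subseteq> W \<union> N" "finite X" "card X = h" "\<not> X \<subseteq> W" using that by (auto simp: Y_def nsets_def)
    then have X_eq: "X = (X \<inter> W) \<union> (X \<inter> N)" by auto
    have "card X = card (X \<inter> W) + card (X \<inter> N)"
      using X \<open>W \<inter> N = {}\<close> by (subst X_eq, subst card_Un_disjoint) auto
    moreover have "card (X \<inter> W) < card X" using X by (intro psubset_card_mono) auto
    moreover have "T e = X \<longleftrightarrow> T1 e = X \<inter> W \<and> T2 e = X \<inter> N" if "e \<in> E" for e
      using T_W[OF that] T_N[OF that] X_eq by (metis T_def)
    then have "{e\<in>E. T e = X} = {e\<in>E. T1 e = X \<inter> W \<and> T2 e = X \<inter> N}" by blast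
    ultimately show ?thesis using T2_count[of "X \<inter> N" "X \<inter> W"] X by simp
  qed
  then have "\<exists>f. bij_betw f {..<lam} {e\<in>E. T e = X}" if "X \<in> Y" for X
    using ex_bij_betw_nat_finite[of "{e\<in>E. T e = X}"] that \<open>finite E\<close> by (auto simp: atLeast0LessThan)
  \<comment> \<open>The \<open>lam\<close> copies of \<open>X\<close> are matched arbitrarily with
    the \<open>lam\<close> abstract edges of vertex set \<open>X\<close>.\<close>
  then obtain f where f: "\<And>X. X \<in> Y \<Longrightarrow> bij_betw (f X) {..<lam} {e\<in>E. T e = X}" by metis
  define \<phi> where "\<phi> = (\<lambda>(X, j). f X j)"
  have \<phi>: "\<phi> y \<in> E" "T (\<phi> y) = fst y" if "y \<in> Y \<times> {..<lam}" for y
  proof -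
    obtain X j where y: "y = (X, j)" "X \<in> Y" "j < lam" using \<open>y \<in> Y \<times> {..<lam}\<close> by auto
    then have "f X j \<in> {e\<in>E. T e = X}" using bij_betwE[OF f[of X]] by simp
    then show "\<phi> y \<in> E" "T (\<phi> y) = fst y" using y by (auto simp: \<phi>_def)
  qed
  have T_Y: "T e \<in> Y" if "e \<in> E" for e
  proof -
    have "finite (T1 e)" "finite (T2 e)" using T1(1)[OF that] T2(1)[OF that] fin finite_subset by blast+
    then have "card (T e) = card (T1 e) + card (T2 e)"
      unfolding T_def using T1(1)[OF that] T2(1)[OF that] fin by (intro card_Un_disjoint) auto
    then have "card (T e) = h" using T2(2)[OF that] T1_less[OF that] by simp
    moreover have "T2 e \<noteq> {}" using T2(2)[OF that] T1_less[OF that] by auto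
    then have "\<not> T e \<subseteq> W" using T2(1)[OF that] \<open>W \<inter> N = {}\<close> by (auto simp: T_def)
    moreover have "T e \<subseteq> W \<union> N" "finite (T e)"
      using T1(1)[OF that] T2(1)[OF that] \<open>finite (T1 e)\<close> \<open>finite (T2 e)\<close> by (auto simp: T_def)
    ultimately show ?thesis by (auto simp: Y_def nsets_def)
  qed
  have bij: "bij_betw \<phi> (Y \<times> {..<lam}) E"
  proof (rule bij_betw_imageI)
    show "inj_on \<phi> (Y \<times> {..<lam})"
    proof (rule inj_onI)
      fix y y' assume y: "y \<in> Y \<times> {..<lam}" "y' \<in> Y \<times> {..<lam}" "\<phi> y = \<phi> y'"
      then have "fst y = fst y'" using \<phi>(2) by metis
      with y show "y = y'" using f[of "fst y"] by (auto simp: \<phi>_def bij_betw_def inj_on_def)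
    qed
    show "\<phi> ` (Y \<times> {..<lam}) = E"
    proof
      show "E \<subseteq> \<phi> ` (Y \<times> {..<lam})"
      proof
        fix e assume "e \<in> E"
        then have "e \<in> f (T e) ` {..<lam}" using f[OF T_Y[of e]] by (auto simp: bij_betw_def)
        then obtain j where "j < lam" "e = \<phi> (T e, j)" by (auto simp: \<phi>_def)
        then show "e \<in> \<phi> ` (Y \<times> {..<lam})" using T_Y[OF \<open>e \<in> E\<close>] by blast
      qed
    qed (use \<phi> in auto)
  qed
  define col where "col = c \<circ> \<phi>"
  have card_col: "card {y \<in> Y \<times> {..<lam}. col y = i \<and> u \<in> fst y} = card {e\<in>E. c e = i \<and> u \<in> T e}" for i u
  proof (rule bij_betw_same_card[of \<phi>])
    show "bij_betw \<phi> {y \<in> Y \<times> {..<lam}. col y = i \<and> u \<in> fst y} {e\<in>E. c e = i \<and> u \<in> T e}"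
      using \<phi>(2) by (intro bij_betw_Collect[OF bij]) (simp only: col_def comp_apply)
  qed
  have "card {y \<in> Y \<times> {..<lam}. col y = i \<and> w \<in> fst y} = D i" if "i < \<kappa>" "w \<in> W" for i w
  proof -
    have "{e\<in>E. c e = i \<and> w \<in> T e} = {e\<in>E. c e = i \<and> w \<in> T1 e}" using T_W that by auto
    then show ?thesis using T1_deg[of i w] that \<open>c ` E = _\<close> card_col by simp
  qed
  moreover have "card {y \<in> Y \<times> {..<lam}. col y = i \<and> v \<in> fst y} = s" if "i < \<kappa>" "v \<in> N" for i v
  proof -
    have "{e\<in>E. c e = i \<and> v \<in> T e} = {e\<in>E. c e = i \<and> v \<in> T2 e}" using T_N that by auto
    then show ?thesis using T2_deg[of i v] that \<open>c ` E = _\<close> card_col by simp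
  qed
  moreover have "linked id (\<lambda>y. fst y \<inter> N) {y \<in> Y \<times> {..<lam}. col y = i}" if "i < \<kappa>" for i
    unfolding linked_def
  proof (intro allI impI)
    fix A assume A: "A \<subseteq> {y \<in> Y \<times> {..<lam}. col y = i}" "A \<noteq> {}"
      and closed: "\<forall>y\<in>A. \<forall>y'\<in>{y \<in> Y \<times> {..<lam}. col y = i}.
        id y = id y' \<or> (fst y \<inter> N) \<inter> (fst y' \<inter> N) \<noteq> {} \<longrightarrow> y' \<in> A"
    \<comment> \<open>Linkedness is transported along the bijection: \<open>fst y \<inter> N\<close>
      equals \<open>T2 (\<phi> y)\<close>, so a closed set of labelled edges has a closed
      image.\<close>
    have "\<phi> ` A = {e\<in>E. c e = i}"
    proof -
      have "\<phi> ` A \<subseteq> {e\<in>E. c e = i}" using A \<phi>(1) by (auto simp: col_def)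
      moreover have "\<forall>e\<in>\<phi> ` A. \<forall>e'\<in>{e\<in>E. c e = i}. id e = id e' \<or> T2 e \<inter> T2 e' \<noteq> {} \<longrightarrow> e' \<in> \<phi> ` A"
      proof (intro ballI impI)
        fix e e' assume e: "e \<in> \<phi> ` A" "e' \<in> {e\<in>E. c e = i}" and or: "id e = id e' \<or> T2 e \<inter> T2 e' \<noteq> {}"
        obtain y where y: "y \<in> A" "e = \<phi> y" using e by blast
        obtain y' where y': "y' \<in> Y \<times> {..<lam}" "e' = \<phi> y'" using e bij by (auto simp: bij_betw_def)
        have yY: "y \<in> Y \<times> {..<lam}" using y A by blast
        show "e' \<in> \<phi> ` A"
        proof (cases "e = e'")
          case False
          then have "T2 e \<inter> T2 e' \<noteq> {}" using or by simp
          moreover have "fst y \<inter> N = T2 e" "fst y' \<inter> N = T2 e'"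
            using T_N[of e] T_N[of e'] \<phi>[OF yY] \<phi>[OF y'(1)] y y' by auto
          ultimately have "(fst y \<inter> N) \<inter> (fst y' \<inter> N) \<noteq> {}" by simp
          moreover have "y' \<in> {y \<in> Y \<times> {..<lam}. col y = i}"
            using y' e by (simp add: col_def del: mem_Sigma_iff)
          ultimately have "y' \<in> A" using bspec[OF closed y(1)] by blast
          then show ?thesis using y' by blast
        qed (use e in simp)
      qed
      ultimately show ?thesis using T2_linked[of i] that \<open>c ` E = _\<close> A unfolding linked_def by auto
    qed
    show "A = {y \<in> Y \<times> {..<lam}. col y = i}"
    proof
      show "{y \<in> Y \<times> {..<lam}. col y = i} \<subseteq> A"
      proof
        fix y assume y: "y \<in> {y \<in> Y \<times> {..<lam}. col y = i}"
        then have "\<phi> y \<in> \<phi> ` A" using \<phi>(1) \<open>\<phi> ` A = _\<close> by (auto simp: col_def)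
        then obtain y' where "y' \<in> A" "\<phi> y = \<phi> y'" by blast
        moreover have "y' \<in> Y \<times> {..<lam}" using \<open>y' \<in> A\<close> A by blast
        ultimately show "y \<in> A" using bij y unfolding bij_betw_def inj_on_def by blast
      qed
    qed (use A in simp)
  qed
  moreover have "col y < \<kappa>" if "y \<in> Y \<times> {..<lam}" for y using \<phi>(1)[OF that] c_less by (simp add: col_def)
  ultimately show ?thesis by (intro that[of col])
qed

section \<open>Numbers of edges of each type\<close>

lemma exists_bounded_sum:
  fixes u :: "nat \<Rightarrow> nat"
  shows "M \<le> (\<Sum>i<\<kappa>. u i) \<Longrightarrow> \<exists>x. (\<Sum>i<\<kappa>. x i) = M \<and> (\<forall>i<\<kappa>. x i \<le> u i)"
proof (induction \<kappa> arbitrary: M)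
  case (Suc \<kappa>)
  have "M - min M (u \<kappa>) \<le> (\<Sum>i<\<kappa>. u i)" using Suc.prems by simp
  from Suc.IH[OF this] obtain x where x: "(\<Sum>i<\<kappa>. x i) = M - min M (u \<kappa>)" "\<forall>i<\<kappa>. x i \<le> u i" by blast
  have "(\<Sum>i<\<kappa>. (x(\<kappa> := min M (u \<kappa>))) i) = (\<Sum>i<\<kappa>. x i)" by (intro sum.cong) auto
  with x show ?case by (intro exI[of _ "x(\<kappa> := min M (u \<kappa>))"]) (auto simp: less_Suc_eq)
qed simp

text \<open>Places \<open>M\<close> items of size \<open>w\<close> into bins of capacity
  \<open>cap i\<close>; rounding wastes at most \<open>w - 1\<close> per bin, which is the slack
  term \<open>(w - 1) * \<kappa>\<close>.\<close>

lemma exists_packing: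
  fixes cap :: "nat \<Rightarrow> nat"
  assumes "w > 0" "w * M + (w - 1) * \<kappa> \<le> (\<Sum>i<\<kappa>. cap i)"
  shows "\<exists>x. (\<Sum>i<\<kappa>. x i) = M \<and> (\<forall>i<\<kappa>. w * x i \<le> cap i)"
proof -
  have "cap i \<le> w * (cap i div w) + (w - 1)" for i
    using \<open>w > 0\<close> mod_less_divisor[of w "cap i"] mult_div_mod_eq[of w "cap i"] by linarith
  then have "(\<Sum>i<\<kappa>. cap i) \<le> (\<Sum>i<\<kappa>. w * (cap i div w) + (w - 1))" by (intro sum_mono)
  also have "\<dots> = w * (\<Sum>i<\<kappa>. cap i div w) + (w - 1) * \<kappa>" by (simp add: sum.distrib sum_distrib_left)
  finally have "w * M \<le> w * (\<Sum>i<\<kappa>. cap i div w)" using assms(2) by linarith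
  then have "M \<le> (\<Sum>i<\<kappa>. cap i div w)" using \<open>w > 0\<close> by simp
  then obtain x where x: "(\<Sum>i<\<kappa>. x i) = M" "\<forall>i<\<kappa>. x i \<le> cap i div w" using exists_bounded_sum by blast
  have "w * x i \<le> cap i" if "i < \<kappa>" for i
  proof -
    have "w * x i \<le> w * (cap i div w)" using x that by simp
    then show ?thesis using order_trans times_div_less_eq_dividend by blast
  qed
  with x show ?thesis by blast
qed

text \<open>Both sides count the \<open>h\<close>-sets with a marked element in the part of size
  \<open>m\<close>; the proof is absorption followed by Vandermonde.\<close>

lemma weighted_vandermonde:
  assumes "m > 0" "h > 0"
  shows "(\<Sum>a\<le>h. a * (m choose a) * (p choose (h - a))) = m * ((m + p - 1) choose (h - 1))"
proof -
  obtain m' h' where eq: "m = Suc m'" "h = Suc h'" using assms by (metis gr0_implies_Suc)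
  have "(\<Sum>a\<le>h. a * (m choose a) * (p choose (h - a)))
      = (\<Sum>a\<le>h'. Suc a * (m choose Suc a) * (p choose (h' - a)))"
    unfolding eq by (subst sum.atMost_Suc_shift) simp
  also have "\<dots> = (\<Sum>a\<le>h'. m * ((m' choose a) * (p choose (h' - a))))"
    by (intro sum.cong) (simp_all only: eq Suc_times_binomial mult.assoc)
  also have "\<dots> = m * ((m' + p) choose h')" by (simp add: vandermonde flip: sum_distrib_left)
  finally show ?thesis by (simp add: eq)
qed

lemma six_choose_three: "6 * ((Q + 3) choose 3) = (Q + 3) * (Q + 2) * (Q + 1)"
proof (induction Q)
  case (Suc Q)
  have two: "2 * ((Q + 3) choose 2) = (Q + 3) * (Q + 2)" using choose_two[of "Q + 3"] by simp
  have "6 * ((Suc Q + 3) choose 3) = 6 * ((Q + 3) choose 3) + 3 * (2 * ((Q + 3) choose 2))"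
    by (simp add: eval_nat_numeral)
  then show ?case unfolding Suc two by (simp add: algebra_simps)
qed simp

text \<open>Because \<open>n \<ge> 3 * m\<close>, each of the three factors on the left is at most
  3/2 times the corresponding one on the right, and (3/2)^3 = 27/8 is less than \<open>m\<close>.
  The constants 48 and 162 are 6 * 8 and 6 * 27.\<close>

lemma choose_three_le:
  assumes "m > 4" "n \<ge> 4 * m"
  shows "(n - 1) choose 3 \<le> m * ((n - m) choose 3)"
proof -
  define Q where "Q = n - 4"
  define P where "P = n - m - 3"
  have Q: "n - 1 = Q + 3" and P: "n - m = P + 3" using assms by (auto simp: Q_def P_def)
  have "2 * Q + 2 \<le> 3 * P + 3" using assms unfolding Q_def P_def by linarith
  then have le: "2 * (Q + j) \<le> 3 * (P + j)" if "j \<ge> 1" for j using that by (simp add: algebra_simps)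
  have "48 * ((n - 1) choose 3) = (2 * (Q + 3)) * (2 * (Q + 2)) * (2 * (Q + 1))"
    unfolding Q using six_choose_three[of Q] by (simp add: algebra_simps)
  also have "\<dots> \<le> (3 * (P + 3)) * (3 * (P + 2)) * (3 * (P + 1))" by (intro mult_le_mono le) auto
  also have "\<dots> = 162 * ((n - m) choose 3)" unfolding P using six_choose_three[of P] by (simp add: algebra_simps)
  also have "\<dots> \<le> 48 * (m * ((n - m) choose 3))"
  proof -
    have "162 * ((n - m) choose 3) \<le> (48 * m) * ((n - m) choose 3)"
      using assms by (intro mult_right_mono) auto
    then show ?thesis by simp
  qed
  finally show ?thesis by simp
qed

text \<open>A colour has two constraints, its degree sums over \<open>W\<close> and over the
  complement. With types 3 and 2 placed, these determine types 1 and 0; the totals over all colours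
  of the last two types then come out right by double counting.\<close>

lemma exists_type_numbers:
  fixes m n r s lam q \<kappa> :: nat
  assumes "m > 4" "n \<ge> 4 * m" "r > 0" "r < s" "4 dvd r * m" "4 dvd s * n"
    and \<kappa>: "\<kappa> * s = lam * ((n - 1) choose 3)" and q: "q * r = lam * ((m - 1) choose 3)" and "q \<le> \<kappa>"
  defines "D \<equiv> \<lambda>i. if i < q then s - r else s"
  obtains x :: "nat \<Rightarrow> nat \<Rightarrow> nat" where
    "\<And>a. a < 4 \<Longrightarrow> (\<Sum>i<\<kappa>. x i a) = lam * (m choose a) * ((n - m) choose (4 - a))"
    "\<And>i. i < \<kappa> \<Longrightarrow> (\<Sum>a<4. x i a * a) = D i * m"
    "\<And>i. i < \<kappa> \<Longrightarrow> (\<Sum>a<4. x i a * (4 - a)) = s * (n - m)"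
    "\<And>i. i < \<kappa> \<Longrightarrow> (\<Sum>a<4. x i a) + (n - m) \<le> s * (n - m) + 1"
proof -
  define p where "p = n - m"
  have n: "n = m + p" and p3: "3 * m \<le> p" using assms by (auto simp: p_def)
  define B where "B a = lam * (m choose a) * (p choose (4 - a))" for a
  have lessThan4: "{..<4::nat} = {0, 1, 2, 3}" and atMost4: "{..4::nat} = {0, 1, 2, 3, 4}" by auto
  \<comment> \<open>Degree sum over \<open>W\<close>. The term for \<open>a = 4\<close> belongs to
    the edges inside \<open>W\<close>, whose contribution \<open>m * (q * r)\<close> is that of the
    given factors.\<close>
  have B_W: "B 1 + 2 * B 2 + 3 * B 3 + m * (q * r) = m * (\<kappa> * s)"
  proof -
    have "lam * (\<Sum>a\<le>4. a * (m choose a) * (p choose (4 - a))) = lam * (m * ((m + p - 1) choose 3))"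
      using weighted_vandermonde[of m 4 p] assms by simp
    moreover have "4 * (m choose 4) = m * ((m - 1) choose 3)"
      using times_binomial_minus1_eq[of 4 m] by simp
    ultimately show ?thesis unfolding \<kappa> q B_def atMost4 by (simp add: n algebra_simps)
  qed
  have B_N: "4 * B 0 + 3 * B 1 + 2 * B 2 + B 3 = p * (\<kappa> * s)"
  proof -
    have "lam * (\<Sum>a\<le>4. a * (p choose a) * (m choose (4 - a))) = lam * (p * ((p + m - 1) choose 3))"
      using weighted_vandermonde[of p 4 m] assms p3 by simp
    then show ?thesis unfolding \<kappa> B_def atMost4 by (simp add: n algebra_simps)
  qed
  have sum_D: "(\<Sum>i<\<kappa>. D i) + q * r = \<kappa> * s"
  proof -
    have "(\<Sum>i<\<kappa>. D i) + (\<Sum>i<\<kappa>. if i < q then r else 0) = (\<Sum>i<\<kappa>. s)"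
      unfolding sum.distrib[symmetric] using \<open>r < s\<close> by (intro sum.cong) (auto simp: D_def)
    moreover have "{..<\<kappa>} \<inter> {i. i < q} = {..<q}" using \<open>q \<le> \<kappa>\<close> by auto
    then have "(\<Sum>i<\<kappa>. if i < q then r else 0) = q * r" by (simp add: sum.If_cases)
    ultimately show ?thesis by simp
  qed
  define cap where "cap i = D i * m" for i
  have sum_cap: "(\<Sum>i<\<kappa>. cap i) = B 1 + 2 * B 2 + 3 * B 3"
  proof -
    have "(\<Sum>i<\<kappa>. cap i) + m * (q * r) = m * (\<kappa> * s)"
      unfolding cap_def sum_D[symmetric] by (simp add: algebra_simps sum_distrib_left)
    with B_W show ?thesis by simp
  qed
  \<comment> \<open>The slack for both packings: size 3 wastes at most 2 per colour and size 2 at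
    most 1, and the edges of type 1 can fill any gap.\<close>
  have "2 * \<kappa> \<le> B 1"
  proof -
    have "2 * \<kappa> \<le> \<kappa> * s" using mult_le_mono2[of 2 s \<kappa>] \<open>r > 0\<close> \<open>r < s\<close> by simp
    also have "\<dots> \<le> lam * (m * (p choose 3))"
      unfolding \<kappa> p_def using assms by (intro mult_le_mono2 choose_three_le)
    finally show ?thesis by (simp add: B_def mult.assoc)
  qed
  then obtain x3 where x3: "(\<Sum>i<\<kappa>. x3 i) = B 3" "\<And>i. i < \<kappa> \<Longrightarrow> 3 * x3 i \<le> cap i"
    using exists_packing[of 3 "B 3" \<kappa> cap] sum_cap by auto
  have "(\<Sum>i<\<kappa>. cap i - 3 * x3 i) + 3 * B 3 = (\<Sum>i<\<kappa>. cap i)"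
    unfolding x3(1)[symmetric] sum_distrib_left sum.distrib[symmetric] using x3(2) by (intro sum.cong) auto
  then have "2 * B 2 + (2 - 1) * \<kappa> \<le> (\<Sum>i<\<kappa>. cap i - 3 * x3 i)" using sum_cap \<open>2 * \<kappa> \<le> B 1\<close> by simp
  then obtain x2 where x2: "(\<Sum>i<\<kappa>. x2 i) = B 2" "\<And>i. i < \<kappa> \<Longrightarrow> 2 * x2 i \<le> cap i - 3 * x3 i"
    using exists_packing[of 2 "B 2" \<kappa> "\<lambda>i. cap i - 3 * x3 i"] by auto
  define x1 where "x1 i = cap i - 3 * x3 i - 2 * x2 i" for i
  \<comment> \<open>The number of new edges of colour \<open>i\<close>: an \<open>s\<close>-factor
    has \<open>s * n / 4\<close> edges, and a given \<open>r\<close>-factor supplies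
    \<open>r * m / 4\<close> of them. The divisibility by 4 in admissibility makes both
    exact.\<close>
  define tot where "tot i = s * n div 4 - (if i < q then r * m div 4 else 0)" for i
  define x0 where "x0 i = tot i - x1 i - x2 i - x3 i" for i
  have x1: "x1 i + 2 * x2 i + 3 * x3 i = cap i" if "i < \<kappa>" for i
    using x2(2)[OF that] x3(2)[OF that] by (simp add: x1_def)
  have tot: "4 * tot i = cap i + s * p" for i
  proof -
    obtain u v where uv: "s * n = 4 * u" "r * m = 4 * v" using assms by (meson dvdE)
    obtain t where t: "s = r + t" using \<open>r < s\<close> less_imp_add_positive by blast
    have "4 * u = r * m + t * m + s * p" unfolding uv(1)[symmetric] n t by (simp add: algebra_simps)
    moreover have "tot i = u - (if i < q then v else 0)" by (simp add: tot_def uv)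
    moreover have "cap i = (if i < q then t * m else r * m + t * m)"
      by (simp add: cap_def D_def t algebra_simps)
    ultimately show ?thesis using uv(2) by (simp add: diff_mult_distrib2)
  qed
  have sm: "3 * (s * m) \<le> s * p" using mult_le_mono2[OF p3, of s] by (metis mult.left_commute)
  have cap_le: "cap i \<le> s * m" for i by (simp add: cap_def D_def)
  \<comment> \<open>By \<open>4 * tot i = cap i + s * p\<close> this amounts to
    \<open>3 * cap i \<le> s * p\<close>, which follows from \<open>cap i \<le> s * m\<close> and
    \<open>3 * m \<le> p\<close>. As \<open>x1 i + x2 i + x3 i \<le> cap i\<close>, the subtraction
    in \<open>x0\<close> is not truncated.\<close>
  have "cap i \<le> tot i" for i using tot[of i] cap_le[of i] sm by linarith
  then have x0: "x0 i + x1 i + x2 i + x3 i = tot i" if "i < \<kappa>" for i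
    using x1[OF that] order_trans[of "x1 i + x2 i + x3 i" "cap i" "tot i"] by (simp add: x0_def)
  define x where "x i a = (if a = 0 then x0 i else if a = 1 then x1 i else if a = 2 then x2 i else x3 i)"
    for i and a :: nat
  have sum_x1: "(\<Sum>i<\<kappa>. x1 i) = B 1"
  proof -
    have "(\<Sum>i<\<kappa>. x1 i) + 2 * B 2 + 3 * B 3 = (\<Sum>i<\<kappa>. cap i)"
      unfolding x3(1)[symmetric] x2(1)[symmetric] sum_distrib_left sum.distrib[symmetric]
      using x1 by (intro sum.cong) auto
    then show ?thesis using sum_cap by simp
  qed
  have sum_x0: "(\<Sum>i<\<kappa>. x0 i) = B 0"
  proof -
    have "4 * ((\<Sum>i<\<kappa>. x0 i) + B 1 + B 2 + B 3) = (\<Sum>i<\<kappa>. 4 * (x0 i + x1 i + x2 i + x3 i))"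
      by (simp add: sum_x1 x2(1) x3(1) sum.distrib flip: sum_distrib_left)
    also have "\<dots> = (\<Sum>i<\<kappa>. cap i + s * p)" using x0 tot by (intro sum.cong) auto
    also have "\<dots> = B 1 + 2 * B 2 + 3 * B 3 + p * (\<kappa> * s)" by (simp add: sum.distrib sum_cap)
    finally show ?thesis using B_N by simp
  qed
  show ?thesis
  proof (rule that[of x])
    show "(\<Sum>i<\<kappa>. x i a) = lam * (m choose a) * ((n - m) choose (4 - a))" if "a < 4" for a
    proof -
      have "(\<Sum>i<\<kappa>. x i a) = B a"
        using that sum_x0 sum_x1 x2(1) x3(1) by (auto simp: x_def less_Suc_eq eval_nat_numeral)
      then show ?thesis by (simp add: B_def p_def)
    qed
    fix i assume i: "i < \<kappa>"
    show "(\<Sum>a<4. x i a * a) = D i * m"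
      using x1[OF i] by (simp add: lessThan4 x_def cap_def)
    show "(\<Sum>a<4. x i a * (4 - a)) = s * (n - m)"
      using x1[OF i] x0[OF i] tot[of i] by (simp add: lessThan4 x_def p_def)
    \<comment> \<open>Since \<open>s \<ge> 2\<close>, \<open>p\<close> is at most half of
      \<open>s * p\<close>, while \<open>tot i\<close> is at most a third of it.\<close>
    have "2 * p \<le> s * p" using mult_le_mono1[of 2 s p] \<open>r > 0\<close> \<open>r < s\<close> by simp
    then have "tot i + p \<le> s * p + 1" using tot[of i] cap_le[of i] sm by linarith
    then show "(\<Sum>a<4. x i a) + (n - m) \<le> s * (n - m) + 1"
      using x0[OF i] by (simp add: lessThan4 x_def p_def)
  qed
qed

section \<open>Factorizations and their extensions\<close>

lemma sum_degree:
  assumes "finite V" "finite F" "\<And>x. x \<in> F \<Longrightarrow> fst x \<subseteq> V \<and> card (fst x) = h"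
  shows "(\<Sum>v\<in>V. degree F v) = h * card F"
proof -
  have "(\<Sum>v\<in>V. degree F v) = (\<Sum>x\<in>F. card {v\<in>V. v \<in> fst x})"
    unfolding degree_def
    using sum.swap_restrict[OF assms(1,2), of "\<lambda>_ _. 1::nat" "\<lambda>v x. v \<in> fst x"] by simp
  also have "\<dots> = (\<Sum>x\<in>F. h)"
  proof (rule sum.cong)
    fix x assume "x \<in> F"
    then have "fst x \<subseteq> V" "card (fst x) = h" using assms(3) by blast+
    moreover from this have "{v\<in>V. v \<in> fst x} = fst x" by blast
    ultimately show "card {v\<in>V. v \<in> fst x} = h" by simp
  qed simp
  finally show ?thesis by simp
qed

lemma degree_complete_hypergraph:
  assumes "finite V" "v \<in> V" "h > 0"
  shows "degree (complete_hypergraph lam h V) v = lam * ((card V - 1) choose (h - 1))"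
proof -
  have "bij_betw (insert v) {X. X \<subseteq> V - {v} \<and> card X = h - 1} {X \<in> nsets V h. v \<in> X}"
  proof (rule bij_betw_byWitness[where f' = "\<lambda>X. X - {v}"])
    show "insert v ` {X. X \<subseteq> V - {v} \<and> card X = h - 1} \<subseteq> {X \<in> nsets V h. v \<in> X}"
    proof clarify
      fix X assume X: "X \<subseteq> V - {v}" "card X = h - 1"
      then have "finite X" "v \<notin> X" using \<open>finite V\<close> finite_subset by auto
      then have "card (insert v X) = h" using X \<open>h > 0\<close> by simp
      then show "insert v X \<in> nsets V h \<and> v \<in> insert v X"
        using X \<open>finite X\<close> \<open>v \<in> V\<close> by (auto simp: nsets_def)
    qed
  qed (use \<open>h > 0\<close> in \<open>auto simp: nsets_def\<close>)
  then have "card {X \<in> nsets V h. v \<in> X} = card {X. X \<subseteq> V - {v} \<and> card X = h - 1}"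
    by (rule bij_betw_same_card[symmetric])
  also have "\<dots> = (card V - 1) choose (h - 1)" using assms by (subst n_subsets) auto
  finally have "card ({X \<in> nsets V h. v \<in> X} \<times> {..<lam}) = ((card V - 1) choose (h - 1)) * lam"
    by (simp add: card_cartesian_product)
  moreover have "{x \<in> complete_hypergraph lam h V. v \<in> fst x} = {X \<in> nsets V h. v \<in> X} \<times> {..<lam}"
    by (auto simp: complete_hypergraph_def)
  ultimately show ?thesis by (simp add: degree_def)
qed

lemma finite_complete_hypergraph: "finite V \<Longrightarrow> finite (complete_hypergraph lam h V)"
  by (simp add: complete_hypergraph_def finite_imp_finite_nsets)

text \<open>Two double counts: the edges at one fixed vertex are shared out among the factors, and
  the vertex-edge incidences within one factor are counted from both sides.\<close>

lemma factorization_complete_hypergraph: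
  assumes "finite V" "V \<noteq> {}" "h > 0" and P: "is_factorization r V (complete_hypergraph lam h V) P"
  shows "card P * r = lam * ((card V - 1) choose (h - 1))" and "F \<in> P \<Longrightarrow> h * card F = r * card V"
    and "finite P"
proof -
  let ?E = "complete_hypergraph lam h V"
  have part: "partition_on ?E P" and deg: "\<And>F v. F \<in> P \<Longrightarrow> v \<in> V \<Longrightarrow> degree F v = r"
    using P by (auto simp: is_factorization_def is_factor_def)
  have "finite ?E" using \<open>finite V\<close> by (rule finite_complete_hypergraph)
  with part show "finite P" by (rule finite_elements[rotated])
  have sub: "F \<subseteq> ?E" if "F \<in> P" for F using part that by (auto simp: partition_on_def)
  have fin: "finite F" if "F \<in> P" for F using sub[OF that] \<open>finite ?E\<close> finite_subset by blast
  show "h * card F = r * card V" if "F \<in> P"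
  proof -
    have "fst x \<subseteq> V \<and> card (fst x) = h" if "x \<in> ?E" for x
      using that by (auto simp: complete_hypergraph_def nsets_def)
    then have "(\<Sum>v\<in>V. degree F v) = h * card F"
      using sub[OF that] by (intro sum_degree fin that \<open>finite V\<close>) blast
    then show ?thesis using deg that by (simp add: mult.commute)
  qed
  obtain v where v: "v \<in> V" using \<open>V \<noteq> {}\<close> by blast
  have "{x \<in> ?E. v \<in> fst x} = (\<Union>F\<in>P. {x \<in> F. v \<in> fst x})" using part by (auto simp: partition_on_def)
  moreover have "card (\<Union>F\<in>P. {x \<in> F. v \<in> fst x}) = (\<Sum>F\<in>P. card {x \<in> F. v \<in> fst x})"
  proof (rule card_UN_disjoint)
    have "F \<inter> F' = {}" if "F \<in> P" "F' \<in> P" "F \<noteq> F'" for F F'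
      using part that by (auto simp: partition_on_def disjoint_def)
    then show "\<forall>F\<in>P. \<forall>F'\<in>P. F \<noteq> F' \<longrightarrow> {x \<in> F. v \<in> fst x} \<inter> {x \<in> F'. v \<in> fst x} = {}" by blast
  qed (use \<open>finite P\<close> fin in auto)
  ultimately have "degree ?E v = (\<Sum>F\<in>P. degree F v)" by (simp add: degree_def)
  then show "card P * r = lam * ((card V - 1) choose (h - 1))"
    using deg v degree_complete_hypergraph[OF \<open>finite V\<close> v \<open>h > 0\<close>] by simp
qed

text \<open>The edges of \<open>C\<close> all of whose vertices are reachable from \<open>u\<close>
  form a closed set, since an edge that overlaps one of them can be walked into. Linkedness makes
  this set all of \<open>C\<close>, and \<open>C\<close> covers \<open>V\<close>.\<close>

lemma linked_imp_connected:
  assumes "linked id (\<lambda>y. fst y \<inter> N) C" "C \<subseteq> G"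
    and cover: "\<And>v. v \<in> V \<Longrightarrow> \<exists>y\<in>C. v \<in> fst y"
  shows "connected_hypergraph V G"
  unfolding connected_hypergraph_def
proof (intro ballI)
  fix u v assume "u \<in> V" "v \<in> V"
  obtain y where y: "y \<in> C" "u \<in> fst y" using cover \<open>u \<in> V\<close> by blast
  define A where "A = {y\<in>C. \<forall>z\<in>fst y. (u, z) \<in> (adjacency G)\<^sup>*}"
  have adj: "(a, b) \<in> adjacency G" if "e \<in> C" "a \<in> fst e" "b \<in> fst e" for a b e
    using that \<open>C \<subseteq> G\<close> by (auto simp: adjacency_def)
  have "y \<in> A" unfolding A_def using y adj by blast
  moreover have "e' \<in> A" if e: "e \<in> A" "e' \<in> C" "id e = id e' \<or> (fst e \<inter> N) \<inter> (fst e' \<inter> N) \<noteq> {}" for e e'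
  proof (cases "e = e'")
    case False
    then obtain z where z: "z \<in> fst e" "z \<in> fst e'" using e by auto
    then have "(u, z) \<in> (adjacency G)\<^sup>*" using e by (auto simp: A_def)
    then have "(u, b) \<in> (adjacency G)\<^sup>*" if "b \<in> fst e'" for b
      using adj[OF e(2) z(2) that] by (rule rtrancl_into_rtrancl)
    then show ?thesis using e by (simp add: A_def)
  qed (use e in simp)
  moreover have "A \<subseteq> C" by (auto simp: A_def)
  ultimately have "A = C" using assms(1) unfolding linked_def by blast
  moreover obtain y' where "y' \<in> C" "v \<in> fst y'" using cover \<open>v \<in> V\<close> by blast
  ultimately show "(u, v) \<in> (adjacency G)\<^sup>*" by (auto simp: A_def)
qed

section \<open>Necessity of the conditions\<close>

text \<open>Admissibility comes from the double counts, the upper bound on \<open>s / r\<close> from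
  \<open>card P \<le> card Q\<close>, and strictness of \<open>r < s\<close> from
  connectedness.\<close>

lemma extension_imp_bounds:
  fixes V W :: "'a set"
  assumes "finite V" "W \<subset> V" "h > 0" "lam > 0" "h \<le> card W"
    and P: "is_factorization r W (complete_hypergraph lam h W) P"
    and ext: "extends_to_connected_factorization P s V (complete_hypergraph lam h V)"
  shows "admissible h (card W) r lam" "admissible h (card V) s lam" "r < s"
    "s * ((card W - 1) choose (h - 1)) \<le> r * ((card V - 1) choose (h - 1))"
proof -
  obtain Q f where Q: "is_factorization s V (complete_hypergraph lam h V) Q"
    "\<And>G. G \<in> Q \<Longrightarrow> connected_hypergraph V G"
    and f: "inj_on f P" "\<And>F. F \<in> P \<Longrightarrow> f F \<in> Q \<and> F \<subseteq> f F"
    using ext unfolding extends_to_connected_factorization_def by blast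
  have W: "finite W" "W \<noteq> {}" and V: "V \<noteq> {}" using assms finite_subset by auto
  note countP = factorization_complete_hypergraph[OF W \<open>h > 0\<close> P]
  note countQ = factorization_complete_hypergraph[OF \<open>finite V\<close> V \<open>h > 0\<close> Q(1)]
  \<comment> \<open>Since \<open>h \<le> card W\<close>, there are edges inside \<open>W\<close>, so
    a factor \<open>F\<close> exists from which the divisibility and degree arguments can
    start.\<close>
  have pos: "lam * ((card W - 1) choose (h - 1)) > 0" using assms by simp
  then have "P \<noteq> {}" using countP(1) by auto
  then obtain F where F: "F \<in> P" by blast
  define G where "G = f F"
  have G: "G \<in> Q" "F \<subseteq> G" using f(2)[OF F] by (auto simp: G_def)
  have "r dvd lam * ((card W - 1) choose (h - 1))" using countP(1) by (metis dvd_triv_right)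
  moreover have "h dvd r * card W" using countP(2)[OF F] by (metis dvd_triv_left)
  ultimately show "admissible h (card W) r lam" by (simp add: admissible_def)
  have "s dvd lam * ((card V - 1) choose (h - 1))" using countQ(1) by (metis dvd_triv_right)
  moreover have "h dvd s * card V" using countQ(2)[OF G(1)] by (metis dvd_triv_left)
  ultimately show "admissible h (card V) s lam" by (simp add: admissible_def)
  have "card P \<le> card Q"
    using card_inj_on_le[OF f(1) _ countQ(3)] f(2) by auto
  then have "s * (card P * r) \<le> r * (card Q * s)" by simp
  then have "lam * (s * ((card W - 1) choose (h - 1))) \<le> lam * (r * ((card V - 1) choose (h - 1)))"
    unfolding countP(1) countQ(1) by (simp only: mult.left_commute)
  then show "s * ((card W - 1) choose (h - 1)) \<le> r * ((card V - 1) choose (h - 1))"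
    using \<open>lam > 0\<close> by simp
  have edges: "G \<subseteq> complete_hypergraph lam h V" and F_edges: "F \<subseteq> complete_hypergraph lam h W"
    and deg_G: "\<And>v. v \<in> V \<Longrightarrow> degree G v = s" and deg_F: "\<And>w. w \<in> W \<Longrightarrow> degree F w = r"
    using Q(1) G P F by (auto simp: is_factorization_def is_factor_def)
  have "finite G" using edges finite_complete_hypergraph[OF \<open>finite V\<close>] finite_subset by blast
  have le: "degree F v \<le> degree G v" for v
    unfolding degree_def using \<open>finite G\<close> G by (intro card_mono) auto
  obtain w where w: "w \<in> W" using W by blast
  have "r \<le> s" using le[of w] deg_F[OF w] deg_G[of w] w \<open>W \<subset> V\<close> by auto
  moreover have "r \<noteq> s"
  proof
    assume "r = s"
    \<comment> \<open>If \<open>r = s\<close>, the edges of \<open>F\<close> exhaust the degree of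
      \<open>G\<close> at every vertex of \<open>W\<close>, so no edge of \<open>G\<close> leaves
      \<open>W\<close>, although \<open>W\<close> is a proper subset of \<open>V\<close>.\<close>
    have closed: "b \<in> W" if "(a, b) \<in> adjacency G" "a \<in> W" for a b
    proof -
      obtain x where x: "x \<in> G" "a \<in> fst x" "b \<in> fst x" using \<open>(a, b) \<in> adjacency G\<close> by (auto simp: adjacency_def)
      have "degree F a = degree G a" using deg_F deg_G \<open>a \<in> W\<close> \<open>W \<subset> V\<close> \<open>r = s\<close> by auto
      then have "{x \<in> F. a \<in> fst x} = {x \<in> G. a \<in> fst x}"
        unfolding degree_def using \<open>finite G\<close> G by (intro card_subset_eq) auto
      then have "x \<in> F" using x by blast
      then have "x \<in> complete_hypergraph lam h W" using F_edges by blast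
      then show ?thesis using x by (auto simp: complete_hypergraph_def nsets_def)
    qed
    obtain v where v: "v \<in> V" "v \<notin> W" using \<open>W \<subset> V\<close> by blast
    have "(w, v) \<in> (adjacency G)\<^sup>*"
      using Q(2)[OF G(1)] w v \<open>W \<subset> V\<close> by (auto simp: connected_hypergraph_def)
    then have "v \<in> W" by (induction rule: rtrancl_induct) (use w closed in auto)
    with v show False by blast
  qed
  ultimately show "r < s" by simp
qed

section \<open>Sufficiency: assembling the extended factors\<close>

text \<open>Colour class \<open>i\<close> is united with the \<open>i\<close>-th given factor, if
  there is one; the degree \<open>s - r\<close> on \<open>W\<close> leaves exactly the room for it.
  Connectedness comes from the new edges alone, which reach every vertex because
  \<open>r < s\<close>.\<close>

lemma colouring_imp_extension:
  fixes V W :: "'a set"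
  assumes "finite V" "W \<subseteq> V" "r < s" "V \<noteq> {}"
    and P: "is_factorization r W (complete_hypergraph lam h W) P"
    and "finite P" "card P \<le> \<kappa>"
    and col: "\<And>y. y \<in> (nsets V h - nsets W h) \<times> {..<lam} \<Longrightarrow> col y < \<kappa>"
    and deg_W: "\<And>i w. i < \<kappa> \<Longrightarrow> w \<in> W \<Longrightarrow>
      card {y \<in> (nsets V h - nsets W h) \<times> {..<lam}. col y = i \<and> w \<in> fst y} = (if i < card P then s - r else s)"
    and deg_N: "\<And>i v. i < \<kappa> \<Longrightarrow> v \<in> V - W \<Longrightarrow>
      card {y \<in> (nsets V h - nsets W h) \<times> {..<lam}. col y = i \<and> v \<in> fst y} = s"
    and linked: "\<And>i. i < \<kappa> \<Longrightarrow>
      linked id (\<lambda>y. fst y \<inter> (V - W)) {y \<in> (nsets V h - nsets W h) \<times> {..<lam}. col y = i}"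
  shows "extends_to_connected_factorization P s V (complete_hypergraph lam h V)"
proof -
  define Y where "Y = (nsets V h - nsets W h) \<times> {..<lam}"
  define C where "C i = {y\<in>Y. col y = i}" for i
  let ?K = "complete_hypergraph lam h V" and ?L = "complete_hypergraph lam h W"
  have K: "?K = ?L \<union> Y" and disj: "?L \<inter> Y = {}"
    using nsets_mono[OF \<open>W \<subseteq> V\<close>, of h] by (auto simp: complete_hypergraph_def Y_def)
  have "finite Y" using finite_complete_hypergraph[OF \<open>finite V\<close>, of lam h] K by (metis finite_Un)
  obtain F where F: "bij_betw F {..<card P} P"
    using ex_bij_betw_nat_finite[OF \<open>finite P\<close>] by (auto simp: atLeast0LessThan)
  have part: "partition_on ?L P" using P by (simp add: is_factorization_def)
  \<comment> \<open>Colours beyond \<open>card P\<close> start from the empty set, so that all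
    classes are treated uniformly.\<close>
  define F' where "F' i = (if i < card P then F i else {})" for i
  have F'_L: "F' i \<subseteq> ?L" for i using part F by (auto simp: F'_def partition_on_def bij_betw_def)
  have F'_union: "(\<Union>i<\<kappa>. F' i) = ?L"
  proof -
    have "(\<Union>i<\<kappa>. F' i) = \<Union> (F ` {..<card P})" using \<open>card P \<le> \<kappa>\<close> by (force simp: F'_def split: if_splits)
    then show ?thesis using F part by (simp add: bij_betw_def partition_on_def)
  qed
  have F'_disj: "F' i \<inter> F' j = {}" if "i \<noteq> j" for i j
  proof (cases "i < card P \<and> j < card P")
    case True
    then have "F i \<in> P" "F j \<in> P" "F i \<noteq> F j" using F that by (auto simp: bij_betw_def inj_on_def)
    then show ?thesis using part True by (auto simp: partition_on_def disjoint_def F'_def)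
  qed (auto simp: F'_def)
  define G where "G i = F' i \<union> C i" for i
  have C_Y: "C i \<subseteq> Y" for i by (auto simp: C_def)
  have C_deg: "degree (C i) v = (if v \<in> W \<and> i < card P then s - r else s)" if "i < \<kappa>" "v \<in> V" for i v
  proof -
    have "{x \<in> C i. v \<in> fst x} = {y\<in>Y. col y = i \<and> v \<in> fst y}" by (auto simp: C_def)
    then show ?thesis using deg_W[OF that(1), of v] deg_N[OF that(1), of v] that(2)
      by (cases "v \<in> W") (simp_all add: degree_def Y_def)
  qed
  have F'_deg: "degree (F' i) v = (if v \<in> W \<and> i < card P then r else 0)" for i v
  proof (cases "v \<in> W \<and> i < card P")
    case True
    then have "F i \<in> P" using F by (auto simp: bij_betw_def)
    then show ?thesis using P True by (auto simp: is_factorization_def is_factor_def F'_def)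
  next
    case False
    then have none: "{x \<in> F' i. v \<in> fst x} = {}"
      using F'_L[of i] by (auto simp: F'_def complete_hypergraph_def nsets_def split: if_splits)
    show ?thesis unfolding degree_def none using False by auto
  qed
  have G_deg: "degree (G i) v = s" if "i < \<kappa>" "v \<in> V" for i v
  proof -
    have "{x \<in> G i. v \<in> fst x} = {x \<in> F' i. v \<in> fst x} \<union> {x \<in> C i. v \<in> fst x}" by (auto simp: G_def)
    moreover have "finite (F' i)" "finite (C i)"
      using F'_L[of i] C_Y[of i] \<open>finite Y\<close> finite_complete_hypergraph[OF \<open>finite V\<close>, of lam h] K
      by (metis finite_Un finite_subset)+
    moreover have "{x \<in> F' i. v \<in> fst x} \<inter> {x \<in> C i. v \<in> fst x} = {}" using F'_L[of i] C_Y[of i] disj by blast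
    ultimately have "degree (G i) v = degree (F' i) v + degree (C i) v"
      by (simp add: degree_def card_Un_disjoint)
    then show ?thesis using F'_deg C_deg[OF that] \<open>r < s\<close> by simp
  qed
  have G_disj: "G i \<inter> G j = {}" if "i \<noteq> j" for i j
    using F'_disj[OF that] F'_L C_Y disj that unfolding G_def C_def by blast
  \<comment> \<open>Needed twice: a partition has no empty class, and disjoint classes are distinct
    only if they are nonempty, which gives the injectivity below.\<close>
  have G_ne: "G i \<noteq> {}" if "i < \<kappa>" for i
    using G_deg[OF that] \<open>V \<noteq> {}\<close> \<open>r < s\<close> by (force simp: degree_def)
  have G_union: "(\<Union>i<\<kappa>. G i) = ?K"
  proof -
    have "(\<Union>i<\<kappa>. C i) = Y" using col by (auto simp: C_def Y_def)
    then show ?thesis using F'_union by (auto simp: G_def K)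
  qed
  have "partition_on ?K (G ` {..<\<kappa>})"
  proof (rule partition_onI)
    fix A B assume "A \<in> G ` {..<\<kappa>}" "B \<in> G ` {..<\<kappa>}" "A \<noteq> B"
    then obtain i j where "A = G i" "B = G j" "i \<noteq> j" by blast
    then show "disjnt A B" using G_disj by (simp add: disjnt_def)
  qed (use G_union G_ne in auto)
  moreover have "is_factor s V ?K (G i)" if "i < \<kappa>" for i
    using G_deg[OF that] G_union that by (auto simp: is_factor_def)
  ultimately have "is_factorization s V ?K (G ` {..<\<kappa>})" by (auto simp: is_factorization_def)
  moreover have "connected_hypergraph V (G i)" if "i < \<kappa>" for i
  proof (rule linked_imp_connected)
    show "linked id (\<lambda>y. fst y \<inter> (V - W)) (C i)" using linked[OF that] by (simp add: C_def Y_def)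
    show "\<exists>y\<in>C i. v \<in> fst y" if v: "v \<in> V" for v
    proof -
      have "degree (C i) v > 0" using C_deg[OF \<open>i < \<kappa>\<close> v] \<open>r < s\<close> by auto
      then have "{x \<in> C i. v \<in> fst x} \<noteq> {}" by (metis card.empty degree_def less_irrefl)
      then show ?thesis by blast
    qed
  qed (simp add: G_def)
  moreover have "\<exists>f. inj_on f P \<and> (\<forall>H\<in>P. f H \<in> G ` {..<\<kappa>} \<and> H \<subseteq> f H)"
  proof (intro exI conjI ballI)
    define ix where "ix = inv_into {..<card P} F"
    have ix: "ix H < card P" "F (ix H) = H" if "H \<in> P" for H
      using that F inv_into_into[of H F "{..<card P}"] f_inv_into_f[of H F "{..<card P}"]
      by (auto simp: ix_def bij_betw_def)
    show "inj_on (\<lambda>H. G (ix H)) P"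
    proof (rule inj_onI)
      fix H H' assume H: "H \<in> P" "H' \<in> P" "G (ix H) = G (ix H')"
      then have "G (ix H) \<inter> G (ix H') \<noteq> {}" using G_ne[of "ix H"] ix(1)[of H] \<open>card P \<le> \<kappa>\<close> by simp
      then have "ix H = ix H'" using G_disj by blast
      then have "F (ix H) = F (ix H')" by (rule arg_cong)
      then show "H = H'" unfolding ix(2)[OF H(1)] ix(2)[OF H(2)] .
    qed
    fix H assume H: "H \<in> P"
    show "G (ix H) \<in> G ` {..<\<kappa>}" using ix(1)[OF H] \<open>card P \<le> \<kappa>\<close> by simp
    show "H \<subseteq> G (ix H)" using ix[OF H] by (auto simp: G_def F'_def)
  qed
  ultimately show ?thesis unfolding extends_to_connected_factorization_def by blast
qed

theorem theorem8p7:
  fixes m n r s lam :: nat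
    and V W :: "'a set"
    and P :: "'a edge set set"
  assumes "m > 4" "n \<ge> 4 * m" "r > 0" "s > 0" "lam > 0"
    and "card V = n" "W \<subseteq> V" "card W = m"
    and "is_factorization r W (induced (complete_hypergraph lam 4 V) W) P"
  shows "extends_to_connected_factorization P s V (complete_hypergraph lam 4 V) \<longleftrightarrow>
     (admissible 4 m r lam \<and> admissible 4 n s lam) \<and>
     (1 < real s / real r \<and>
      real s / real r \<le> real ((n - 1) choose 3) / real ((m - 1) choose 3))"
proof -
  have "n > 0" "m > 0" "m < n" using assms by auto
  then have V: "finite V" "V \<noteq> {}" and W: "finite W" "W \<noteq> {}"
    using assms(6,8) by (auto intro: card_ge_0_finite)
  have P: "is_factorization r W (complete_hypergraph lam 4 W) P"
    using assms by (simp add: induced_complete_hypergraph)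
  have m3: "(m - 1) choose 3 > 0" using \<open>m > 4\<close> by simp
  have ratio: "1 < real s / real r \<longleftrightarrow> r < s"
    "real s / real r \<le> real ((n - 1) choose 3) / real ((m - 1) choose 3)
      \<longleftrightarrow> s * ((m - 1) choose 3) \<le> r * ((n - 1) choose 3)"
  proof -
    show "1 < real s / real r \<longleftrightarrow> r < s" using \<open>r > 0\<close> by (simp add: less_divide_eq)
    have "real s / real r \<le> real ((n - 1) choose 3) / real ((m - 1) choose 3)
        \<longleftrightarrow> real (s * ((m - 1) choose 3)) \<le> real (r * ((n - 1) choose 3))"
      using \<open>r > 0\<close> m3 by (simp add: divide_le_eq le_divide_eq field_simps)
    then show "real s / real r \<le> real ((n - 1) choose 3) / real ((m - 1) choose 3)
        \<longleftrightarrow> s * ((m - 1) choose 3) \<le> r * ((n - 1) choose 3)" by (simp only: of_nat_le_iff)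
  qed
  show ?thesis unfolding ratio
  proof
    assume ext: "extends_to_connected_factorization P s V (complete_hypergraph lam 4 V)"
    have "W \<subset> V" using assms(6-8) \<open>m < n\<close> by auto
    then show "(admissible 4 m r lam \<and> admissible 4 n s lam) \<and>
        r < s \<and> s * ((m - 1) choose 3) \<le> r * ((n - 1) choose 3)"
      using extension_imp_bounds[OF V(1) _ _ \<open>lam > 0\<close> _ P ext] assms(1,6,8) by simp
  next
    assume "(admissible 4 m r lam \<and> admissible 4 n s lam) \<and>
        r < s \<and> s * ((m - 1) choose 3) \<le> r * ((n - 1) choose 3)"
    then have adm: "4 dvd r * m" "4 dvd s * n" "s dvd lam * ((n - 1) choose 3)" and "r < s"
      and le: "s * ((m - 1) choose 3) \<le> r * ((n - 1) choose 3)" by (auto simp: admissible_def)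
    obtain \<kappa> where \<kappa>: "\<kappa> * s = lam * ((n - 1) choose 3)" using adm(3) by (metis dvdE mult.commute)
    have q: "card P * r = lam * ((m - 1) choose 3)" and "finite P"
      using factorization_complete_hypergraph[OF W _ P] assms by auto
    \<comment> \<open>The upper bound in (ii) says that there are enough colours to put the given
      factors into distinct ones.\<close>
    have "card P \<le> \<kappa>"
    proof -
      have "lam * (s * ((m - 1) choose 3)) \<le> lam * (r * ((n - 1) choose 3))" using le by simp
      then have "s * (card P * r) \<le> r * (\<kappa> * s)" unfolding q \<kappa> by (simp only: mult.left_commute)
      then have "(r * s) * card P \<le> (r * s) * \<kappa>" by (simp only: ac_simps)
      then show ?thesis using \<open>r > 0\<close> \<open>s > 0\<close> by simp
    qed
    obtain x where x: "\<And>a. a < 4 \<Longrightarrow> (\<Sum>i<\<kappa>. x i a) = lam * (m choose a) * ((n - m) choose (4 - a))"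
      "\<And>i. i < \<kappa> \<Longrightarrow> (\<Sum>a<4. x i a * a) = (if i < card P then s - r else s) * m"
      "\<And>i. i < \<kappa> \<Longrightarrow> (\<Sum>a<4. x i a * (4 - a)) = s * (n - m)"
      "\<And>i. i < \<kappa> \<Longrightarrow> (\<Sum>a<4. x i a) + (n - m) \<le> s * (n - m) + 1"
      by (rule exists_type_numbers[OF assms(1,2,3) \<open>r < s\<close> adm(1,2) \<kappa> q \<open>card P \<le> \<kappa>\<close>], rule that)
    have N: "card (V - W) = n - m" using card_Diff_subset[OF W(1) \<open>W \<subseteq> V\<close>] assms by simp
    then have "card (V - W) \<noteq> 0" using \<open>m < n\<close> by simp
    then have "V - W \<noteq> {}" by (metis card.empty)
    have N_fin: "finite (V - W)" and N_disj: "W \<inter> (V - W) = {}" using V by auto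
    have un: "W \<union> (V - W) = V" using \<open>W \<subseteq> V\<close> by blast
    obtain col where col:
      "\<And>y. y \<in> (nsets V 4 - nsets W 4) \<times> {..<lam} \<Longrightarrow> col y < \<kappa>"
      "\<And>i w. i < \<kappa> \<Longrightarrow> w \<in> W \<Longrightarrow> card {y \<in> (nsets V 4 - nsets W 4) \<times> {..<lam}. col y = i \<and> w \<in> fst y}
        = (if i < card P then s - r else s)"
      "\<And>i v. i < \<kappa> \<Longrightarrow> v \<in> V - W \<Longrightarrow> card {y \<in> (nsets V 4 - nsets W 4) \<times> {..<lam}. col y = i \<and> v \<in> fst y} = s"
      "\<And>i. i < \<kappa> \<Longrightarrow> linked id (\<lambda>y. fst y \<inter> (V - W)) {y \<in> (nsets V 4 - nsets W 4) \<times> {..<lam}. col y = i}"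
      by (rule two_class_colouring[where W = W and N = "V - W" and s = s and h = 4 and \<kappa> = \<kappa> and x = x
            and lam = lam and D = "\<lambda>i. if i < card P then s - r else s",
            unfolded N un \<open>card W = m\<close>, OF W(1) N_fin N_disj \<open>V - W \<noteq> {}\<close> \<open>s > 0\<close> x], assumption+, rule that)
    show "extends_to_connected_factorization P s V (complete_hypergraph lam 4 V)"
      by (rule colouring_imp_extension[OF V(1) \<open>W \<subseteq> V\<close> \<open>r < s\<close> V(2) P \<open>finite P\<close> \<open>card P \<le> \<kappa>\<close>])
        (fact col)+
  qed
qed

end
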